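(* Let $\alpha\ge -1$ be a fixed real number. Then for all sufficiently large $X$, $$\sum_{2\le n\le X}\frac{(\log d_n)^{\alpha}}{d_n}\ll\begin{cases}\dfrac{X}{\log X}\,\dfrac{(\log\log X)^{1+\alpha}}{1+\alpha} & \text{if } \alpha>-1,\\[2mm] \dfrac{X\log\log\log X}{\log X} & \text{if } \alpha=-1,\end{cases}$$ where the implied constant may depend on $\alpha$ but not on $X$.
   Context: $p_n$ denotes the $n$-th prime number and $d_n=p_{n+1}-p_n$. The result is unconditional. $A\ll B$ means $|A|\le C\,B$ for some constant $C>0$. *)

theory Defs
  imports "HOL-Analysis.Analysis" "HOL-Library.Infinite_Set"
    "HOL-Computational_Algebra.Primes"
begin

(* enumerate counts from 0, whereas p_1 = 2 is the first prime; the value at 0 is junk. *)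
definition nth_prime :: "nat \<Rightarrow> nat" where
  "nth_prime n = enumerate {p::nat. prime p} (n - 1)"

(* Natural-number subtraction does not truncate here, since for n \<ge> 1 we have
   nth_prime n < nth_prime (n + 1). *)
definition prime_gap :: "nat \<Rightarrow> nat" where
  "prime_gap n = nth_prime (n + 1) - nth_prime n"

end

theory Submission
  imports Defs "HOL-Number_Theory.Cong" "HOL-Computational_Algebra.Squarefree"
    "HOL-Real_Asymp.Real_Asymp"
begin

text \<open>
  Everything rests on one count: among the first \<open>X\<close> primes, at most a constant times
  \<open>D X / ln X\<close> are followed by a gap of size at most \<open>D\<close>, uniformly in \<open>D\<close>
  (\<open>eventually_card_prime_gap_le\<close>). Split the gaps at \<open>ln X\<close>. A gap \<open>d\<close> above \<open>ln X\<close>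
  contributes at most \<open>(ln ln X) powr \<alpha> / ln X\<close>, and there are at most \<open>X\<close> of them,
  so together they are of smaller order than the bound. The gaps
  below \<open>ln X\<close> fall into dyadic blocks \<open>2^k \<le> d < 2^(k+1)\<close>; in such a block a term is
  comparable to \<open>k powr \<alpha> / 2^k\<close> and there are at most a constant times \<open>2^k X / ln X\<close>
  terms, so the block contributes a constant times \<open>k powr \<alpha> X / ln X\<close>. Only \<open>k\<close> up to a
  multiple of \<open>ln ln X\<close> occur, and summing \<open>k powr \<alpha>\<close> over them gives
  \<open>(ln ln X) powr (1 + \<alpha>) / (1 + \<alpha>)\<close>, or \<open>ln ln ln X\<close> when \<open>\<alpha> = -1\<close>.

  For the count, a gap \<open>d\<close> after the prime \<open>q\<close> means that \<open>q\<close> and \<open>q + d\<close> are both prime.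
  Selberg's sieve (\<open>selberg_sieve\<close>), applied to the integers \<open>n (n + d)\<close> with \<open>n < N\<close>, bounds
  the number of such \<open>q < N\<close> by a constant times \<open>f(d) N / (ln N)^2\<close>, where
  \<open>f(d) = \<Prod>p | d. 1 + 1/p\<close> (\<open>card_prime_pairs_le\<close>). On average over \<open>d\<close> the factor \<open>f(d)\<close> is
  bounded (\<open>sum_singular_factor_le\<close>), so summing over \<open>d \<le> D\<close> gives \<open>D N / (ln N)^2\<close>. Finally
  Chebyshev's bound, by which the primes of index at most \<open>X\<close> lie below \<open>N = O(X ln X)\<close>
  (\<open>eventually_nth_prime_less\<close>), turns this into \<open>D X / ln X\<close>.

  A squarefree integer is represented throughout by the finite set of its prime factors. Least
  common multiples then become unions, divisibility becomes inclusion, and a multiplicative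
  function is a product over the set.
\<close>

section \<open>Selberg's upper bound sieve\<close>

lemma prod_one_plus_eq_sum_Pow:
  fixes f :: "'a \<Rightarrow> 'b :: comm_semiring_1"
  assumes "finite A"
  shows "(\<Prod>x\<in>A. 1 + f x) = (\<Sum>B\<in>Pow A. \<Prod>x\<in>B. f x)"
  using prod_add[OF assms, of f "\<lambda>_. 1"] by (simp add: add.commute)

text \<open>
  This is Moebius inversion over the subsets of a finite set: the sum is
  \<open>(-1) ^ card U\<close> times the expansion of \<open>\<Prod>x\<in>T - U. 1 + (-1)\<close> over the sets \<open>S - U\<close>.
\<close>

lemma sum_minus_one_power_card_interval:
  assumes "finite T" "U \<subseteq> T"
  shows "(\<Sum>S | U \<subseteq> S \<and> S \<subseteq> T. (-1) ^ card S :: real) = (if U = T then (-1) ^ card T else 0)"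
proof -
  have eq: "{S. U \<subseteq> S \<and> S \<subseteq> T} = (\<lambda>V. U \<union> V) ` Pow (T - U)"
  proof (intro equalityI subsetI)
    fix S assume "S \<in> {S. U \<subseteq> S \<and> S \<subseteq> T}"
    then have "S = U \<union> (S - U)" "S - U \<in> Pow (T - U)" by auto
    then show "S \<in> (\<lambda>V. U \<union> V) ` Pow (T - U)" by blast
  qed (use assms in auto)
  have inj: "inj_on (\<lambda>V. U \<union> V) (Pow (T - U))"
    by (auto simp: inj_on_def)
  have fU: "finite U" using assms finite_subset by blast
  have "(\<Sum>S | U \<subseteq> S \<and> S \<subseteq> T. (-1) ^ card S :: real) = (\<Sum>V\<in>Pow (T - U). (-1) ^ card (U \<union> V))"
    unfolding eq by (subst sum.reindex[OF inj]) simp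
  also have "\<dots> = (\<Sum>V\<in>Pow (T - U). (-1) ^ card U * (\<Prod>x\<in>V. -1))"
  proof (intro sum.cong refl)
    fix V assume V: "V \<in> Pow (T - U)"
    then have "card (U \<union> V) = card U + card V"
      using assms fU by (intro card_Un_disjoint) (auto intro: finite_subset)
    then show "(-1) ^ card (U \<union> V) = (-1) ^ card U * (\<Prod>x\<in>V. -1 :: real)"
      by (simp add: power_add)
  qed
  also have "\<dots> = (-1) ^ card U * (\<Prod>x\<in>T - U. 1 + (-1))"
    using assms by (subst prod_one_plus_eq_sum_Pow) (auto simp: sum_distrib_left)
  also have "\<dots> = (if U = T then (-1) ^ card T else 0)"
    using assms by auto
  finally show ?thesis .
qed

text \<open>
  The members of \<open>F\<close> play the role of the squarefree sieve moduli, and \<open>\<Prod>p\<in>S. g p\<close> that of the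
  density of the integers divisible by the modulus \<open>S\<close>. Closure under subsets is closure under
  divisors; for sets of primes with bounded product it is automatic.
\<close>

locale selberg_weights =
  fixes F :: "'p set set" and g :: "'p \<Rightarrow> real"
  assumes finite_F: "finite F"
    and finite_mem: "S \<in> F \<Longrightarrow> finite S"
    and empty_mem: "{} \<in> F"
    and down_closed: "T \<in> F \<Longrightarrow> S \<subseteq> T \<Longrightarrow> S \<in> F"
    and g_pos: "S \<in> F \<Longrightarrow> p \<in> S \<Longrightarrow> 0 < g p"
    and g_less_1: "S \<in> F \<Longrightarrow> p \<in> S \<Longrightarrow> g p < 1"
begin

text \<open>
  With \<open>\<mu>\<close> the Moebius function and \<open>e\<close> the integer that \<open>S\<close> stands for, the next three formulas
  read \<open>h(e) = \<Prod>p | e. g(p) / (1 - g(p))\<close>, \<open>G = \<Sum>e. h(e)\<close>, and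
  \<open>\<lambda>(e) = \<mu>(e) / (G g(e)) \<Sum>h(f)\<close> over the multiples \<open>f\<close> of \<open>e\<close>. These weights minimise
  the quadratic form of the sieve subject to \<open>\<lambda>(1) = 1\<close>.
\<close>

definition h :: "'p \<Rightarrow> real" where "h p = g p / (1 - g p)"

definition G :: real where "G = (\<Sum>S\<in>F. \<Prod>p\<in>S. h p)"

definition weight :: "'p set \<Rightarrow> real" where
  "weight S = (-1) ^ card S / (G * (\<Prod>p\<in>S. g p)) * (\<Sum>T | T \<in> F \<and> S \<subseteq> T. \<Prod>p\<in>T. h p)"

lemma h_pos: "S \<in> F \<Longrightarrow> p \<in> S \<Longrightarrow> 0 < h p"
  using g_pos g_less_1 by (simp add: h_def)

lemma prod_h_pos: "S \<in> F \<Longrightarrow> 0 < (\<Prod>p\<in>S. h p)"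
  by (intro prod_pos) (use h_pos in blast)

lemma prod_g_pos: "S \<in> F \<Longrightarrow> 0 < (\<Prod>p\<in>S. g p)"
  by (intro prod_pos) (use g_pos in blast)

lemma G_pos: "0 < G"
  unfolding G_def by (rule sum_pos) (use finite_F empty_mem prod_h_pos in auto)

lemma weight_empty: "weight {} = 1"
  using G_pos by (simp add: weight_def G_def)

lemma prod_h_eq: "S \<in> F \<Longrightarrow> (\<Prod>p\<in>S. h p) = (\<Prod>p\<in>S. g p) * (\<Sum>L\<in>Pow S. \<Prod>p\<in>L. h p)"
proof -
  assume S: "S \<in> F"
  have "h p = g p * (1 + h p)" if "p \<in> S" for p
    using g_less_1[OF S that] by (simp add: h_def divide_simps)
  then have "(\<Prod>p\<in>S. h p) = (\<Prod>p\<in>S. g p * (1 + h p))"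
    by (intro prod.cong) auto
  then show ?thesis
    using finite_mem[OF S] by (simp add: prod.distrib prod_one_plus_eq_sum_Pow)
qed

text \<open>
  This is what makes the weights bounded by 1. Writing \<open>h(S) = g(S) \<Sum>h(L)\<close> over the subsets
  \<open>L\<close> of \<open>S\<close>, it suffices to bound the double sum of \<open>h(L) h(T)\<close> over \<open>L \<subseteq> S \<subseteq> T\<close>. Moving the
  factor \<open>h(S)\<close> out leaves \<open>h(L \<union> (T - S))\<close>, and \<open>(L, T)\<close> can be recovered from the member
  \<open>L \<union> (T - S)\<close> of \<open>F\<close>, so each term of \<open>G\<close> is used at most once.
\<close>

lemma sum_supersets_le:
  assumes S: "S \<in> F"
  shows "(\<Sum>T | T \<in> F \<and> S \<subseteq> T. \<Prod>p\<in>T. h p) \<le> (\<Prod>p\<in>S. g p) * G"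
proof -
  define Up where "Up = {T. T \<in> F \<and> S \<subseteq> T}"
  define c where "c = (\<lambda>(L, T). L \<union> (T - S) :: 'p set)"
  have finUp: "finite Up" using finite_F by (simp add: Up_def)
  have fS: "finite S" by (rule finite_mem[OF S])
  have c_in: "c x \<in> F" if "x \<in> Pow S \<times> Up" for x
  proof -
    have "c x \<subseteq> snd x" "snd x \<in> F" using that by (auto simp: c_def Up_def)
    then show ?thesis using down_closed by blast
  qed
  have inj: "inj_on c (Pow S \<times> Up)"
  proof (rule inj_onI, clarsimp simp: c_def Up_def)
    fix L T L' T'
    assume a: "L \<subseteq> S" "S \<subseteq> T" "L' \<subseteq> S" "S \<subseteq> T'" "L \<union> (T - S) = L' \<union> (T' - S)"
    have "L = S \<inter> (L \<union> (T - S))" "L' = S \<inter> (L' \<union> (T' - S))"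
      "T = S \<union> (L \<union> (T - S))" "T' = S \<union> (L' \<union> (T' - S))" using a by auto
    then show "L = L' \<and> T = T'" using a(5) by metis
  qed
  have prod_c: "(\<Prod>p\<in>L. h p) * (\<Prod>p\<in>T. h p) = (\<Prod>p\<in>S. h p) * (\<Prod>p\<in>c (L, T). h p)"
    if "(L, T) \<in> Pow S \<times> Up" for L T
  proof -
    have L: "L \<subseteq> S" and T: "S \<subseteq> T" "T \<in> F" using that by (auto simp: Up_def)
    have fT: "finite T" by (rule finite_mem[OF T(2)])
    have "(\<Prod>p\<in>T. h p) = (\<Prod>p\<in>T - S. h p) * (\<Prod>p\<in>S. h p)"
      using T fT by (intro prod.subset_diff)
    moreover have "(\<Prod>p\<in>c (L, T). h p) = (\<Prod>p\<in>L. h p) * (\<Prod>p\<in>T - S. h p)"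
      unfolding c_def using L fS fT
      by (simp add: prod.union_disjoint finite_subset disjoint_iff subset_iff)
    ultimately show ?thesis by simp
  qed
  have "(\<Sum>L\<in>Pow S. \<Prod>p\<in>L. h p) * (\<Sum>T\<in>Up. \<Prod>p\<in>T. h p)
        = (\<Sum>x\<in>Pow S \<times> Up. (\<Prod>p\<in>fst x. h p) * (\<Prod>p\<in>snd x. h p))"
    by (simp add: sum_product sum.cartesian_product case_prod_beta)
  also have "\<dots> = (\<Sum>x\<in>Pow S \<times> Up. (\<Prod>p\<in>S. h p) * (\<Prod>p\<in>c x. h p))"
    using prod_c by (intro sum.cong) auto
  also have "\<dots> = (\<Prod>p\<in>S. h p) * (\<Sum>W\<in>c ` (Pow S \<times> Up). \<Prod>p\<in>W. h p)"
    by (simp add: sum_distrib_left sum.reindex[OF inj])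
  also have "\<dots> \<le> (\<Prod>p\<in>S. h p) * G"
    unfolding G_def using c_in prod_h_pos
    by (intro mult_left_mono sum_mono2 finite_F less_imp_le[OF prod_h_pos[OF S]])
       (auto intro: less_imp_le)
  also have "\<dots> = (\<Sum>L\<in>Pow S. \<Prod>p\<in>L. h p) * ((\<Prod>p\<in>S. g p) * G)"
    by (subst prod_h_eq[OF S]) simp
  finally have *: "(\<Sum>L\<in>Pow S. \<Prod>p\<in>L. h p) * (\<Sum>T\<in>Up. \<Prod>p\<in>T. h p) \<le> \<dots>" .
  have "0 < (\<Sum>L\<in>Pow S. \<Prod>p\<in>L. h p)"
    using fS by (intro sum_pos) (auto intro: prod_h_pos down_closed[OF S])
  with * show ?thesis by (simp add: Up_def)
qed

lemma abs_weight_le_1: "S \<in> F \<Longrightarrow> \<bar>weight S\<bar> \<le> 1"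
proof -
  assume S: "S \<in> F"
  have nonneg: "0 \<le> (\<Sum>T | T \<in> F \<and> S \<subseteq> T. \<Prod>p\<in>T. h p)"
    by (intro sum_nonneg) (auto intro: less_imp_le prod_h_pos)
  have "\<bar>weight S\<bar> = (\<Sum>T | T \<in> F \<and> S \<subseteq> T. \<Prod>p\<in>T. h p) / (G * (\<Prod>p\<in>S. g p))"
    using nonneg prod_g_pos[OF S] G_pos by (simp add: weight_def abs_mult power_abs)
  also have "\<dots> \<le> 1"
    using sum_supersets_le[OF S] prod_g_pos[OF S] G_pos by (simp add: mult.commute)
  finally show ?thesis .
qed

text \<open>
  Inserting the definition of the weights and exchanging the two sums leaves an alternating sum
  over the sets between \<open>U\<close> and \<open>T\<close>, which vanishes unless \<open>T = U\<close>.
\<close>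

lemma sum_supersets_weight:
  assumes U: "U \<in> F"
  shows "(\<Sum>S | S \<in> F \<and> U \<subseteq> S. (\<Prod>p\<in>S. g p) * weight S) = (-1) ^ card U * (\<Prod>p\<in>U. h p) / G"
proof -
  have "(\<Sum>S | S \<in> F \<and> U \<subseteq> S. (\<Prod>p\<in>S. g p) * weight S)
     = (\<Sum>S | S \<in> F \<and> U \<subseteq> S. \<Sum>T | T \<in> F \<and> S \<subseteq> T. (-1) ^ card S * (\<Prod>p\<in>T. h p) / G)"
  proof (intro sum.cong refl)
    fix S assume "S \<in> {S. S \<in> F \<and> U \<subseteq> S}"
    then show "(\<Prod>p\<in>S. g p) * weight S = (\<Sum>T | T \<in> F \<and> S \<subseteq> T. (-1) ^ card S * (\<Prod>p\<in>T. h p) / G)"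
      using prod_g_pos[of S] G_pos
      by (simp add: weight_def sum_distrib_left sum_divide_distrib field_simps)
  qed
  also have "\<dots> = (\<Sum>T | T \<in> F \<and> U \<subseteq> T. \<Sum>S | S \<in> F \<and> U \<subseteq> S \<and> S \<subseteq> T. (-1) ^ card S * (\<Prod>p\<in>T. h p) / G)"
  proof -
    have "(\<Sum>S | S \<in> F \<and> U \<subseteq> S. \<Sum>T | T \<in> F \<and> S \<subseteq> T. (-1) ^ card S * (\<Prod>p\<in>T. h p) / G)
       = (\<Sum>S\<in>{S\<in>F. U \<subseteq> S}. \<Sum>T\<in>{T. T \<in> {T\<in>F. U \<subseteq> T} \<and> S \<subseteq> T}. (-1) ^ card S * (\<Prod>p\<in>T. h p) / G)"
      by (intro sum.cong) auto
    also have "\<dots> = (\<Sum>T\<in>{T\<in>F. U \<subseteq> T}. \<Sum>S\<in>{S. S \<in> {S\<in>F. U \<subseteq> S} \<and> S \<subseteq> T}. (-1) ^ card S * (\<Prod>p\<in>T. h p) / G)"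
      by (rule sum.swap_restrict) (use finite_F in auto)
    finally show ?thesis by (simp add: conj_ac)
  qed
  also have "\<dots> = (\<Sum>T | T \<in> F \<and> U \<subseteq> T. if T = U then (-1) ^ card U * (\<Prod>p\<in>U. h p) / G else 0)"
  proof (intro sum.cong refl)
    fix T assume "T \<in> {T. T \<in> F \<and> U \<subseteq> T}"
    then have T: "T \<in> F" "U \<subseteq> T" by auto
    then have eq: "{S. S \<in> F \<and> U \<subseteq> S \<and> S \<subseteq> T} = {S. U \<subseteq> S \<and> S \<subseteq> T}"
      using down_closed by blast
    have "(\<Sum>S | S \<in> F \<and> U \<subseteq> S \<and> S \<subseteq> T. (-1) ^ card S * (\<Prod>p\<in>T. h p) / G)
       = (\<Sum>S | U \<subseteq> S \<and> S \<subseteq> T. (-1) ^ card S) * ((\<Prod>p\<in>T. h p) / G)"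
      unfolding eq by (simp add: sum_distrib_right sum_divide_distrib)
    then show "(\<Sum>S | S \<in> F \<and> U \<subseteq> S \<and> S \<subseteq> T. (-1) ^ card S * (\<Prod>p\<in>T. h p) / G)
       = (if T = U then (-1) ^ card U * (\<Prod>p\<in>U. h p) / G else 0)"
      using sum_minus_one_power_card_interval[OF finite_mem[OF T(1)] T(2)] by auto
  qed
  also have "\<dots> = (-1) ^ card U * (\<Prod>p\<in>U. h p) / G"
    using U finite_F by simp
  finally show ?thesis .
qed

text \<open>
  The identity that diagonalises the quadratic form: the coupling of \<open>S\<close> and \<open>T\<close> through
  \<open>1 / g(S \<inter> T) = \<Prod>p\<in>S \<inter> T. 1 + 1 / h(p)\<close> expands into a sum over common subsets.
\<close>

lemma prod_g_Un:
  assumes S: "S \<in> F" and T: "T \<in> F"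
  shows "(\<Prod>p\<in>S \<union> T. g p)
       = (\<Prod>p\<in>S. g p) * (\<Prod>p\<in>T. g p) * (\<Sum>U | U \<in> F \<and> U \<subseteq> S \<and> U \<subseteq> T. 1 / (\<Prod>p\<in>U. h p))"
proof -
  have fin: "finite S" "finite T" using finite_mem[OF S] finite_mem[OF T] by auto
  have ST: "S \<inter> T \<in> F" by (rule down_closed[OF S]) auto
  have "(\<Prod>p\<in>S \<union> T. g p) * (\<Prod>p\<in>S \<inter> T. g p) = (\<Prod>p\<in>S. g p) * (\<Prod>p\<in>T. g p)"
    using fin by (rule prod.union_inter)
  then have "(\<Prod>p\<in>S \<union> T. g p) = (\<Prod>p\<in>S. g p) * (\<Prod>p\<in>T. g p) * (1 / (\<Prod>p\<in>S \<inter> T. g p))"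
    using prod_g_pos[OF ST] by (simp add: field_simps)
  also have "1 / (\<Prod>p\<in>S \<inter> T. g p) = (\<Prod>p\<in>S \<inter> T. 1 + 1 / h p)"
  proof -
    have "1 / g p = 1 + 1 / h p" if "p \<in> S \<inter> T" for p
      using g_pos[OF ST that] by (simp add: h_def diff_divide_distrib)
    then have "(\<Prod>p\<in>S \<inter> T. 1 / g p) = (\<Prod>p\<in>S \<inter> T. 1 + 1 / h p)"
      by (intro prod.cong refl)
    then show ?thesis by (simp add: prod_dividef)
  qed
  also have "\<dots> = (\<Sum>U\<in>Pow (S \<inter> T). 1 / (\<Prod>p\<in>U. h p))"
    using fin by (subst prod_one_plus_eq_sum_Pow) (auto simp: prod_dividef)
  also have "Pow (S \<inter> T) = {U. U \<in> F \<and> U \<subseteq> S \<and> U \<subseteq> T}"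
    using down_closed[OF S] by auto
  finally show ?thesis .
qed

text \<open>
  After diagonalisation the form is the sum over \<open>U\<close> of \<open>(\<Sum>S \<supseteq> U. g(S) \<lambda>(S))^2 / h(U)\<close>; the inner sums are
  \<open>\<plusminus> h(U) / G\<close>, so what remains is \<open>\<Sum>h(U) / G^2 = 1 / G\<close>.
\<close>

lemma quadratic_form_eq:
  "(\<Sum>S\<in>F. \<Sum>T\<in>F. weight S * weight T * (\<Prod>p\<in>S \<union> T. g p)) = 1 / G"
proof -
  define y where "y S = (\<Prod>p\<in>S. g p) * weight S" for S
  have "(\<Sum>S\<in>F. \<Sum>T\<in>F. weight S * weight T * (\<Prod>p\<in>S \<union> T. g p))
      = (\<Sum>S\<in>F. \<Sum>T\<in>F. \<Sum>U\<in>F. if U \<subseteq> S \<and> U \<subseteq> T then y S * y T / (\<Prod>p\<in>U. h p) else 0)"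
  proof (intro sum.cong refl)
    fix S T assume "S \<in> F" "T \<in> F"
    have "weight S * weight T * (\<Prod>p\<in>S \<union> T. g p)
        = y S * y T * (\<Sum>U | U \<in> F \<and> U \<subseteq> S \<and> U \<subseteq> T. 1 / (\<Prod>p\<in>U. h p))"
      by (simp add: prod_g_Un \<open>S \<in> F\<close> \<open>T \<in> F\<close> y_def mult_ac)
    also have "\<dots> = (\<Sum>U | U \<in> F \<and> (U \<subseteq> S \<and> U \<subseteq> T). y S * y T / (\<Prod>p\<in>U. h p))"
      by (simp add: sum_distrib_left)
    finally show "weight S * weight T * (\<Prod>p\<in>S \<union> T. g p)
      = (\<Sum>U\<in>F. if U \<subseteq> S \<and> U \<subseteq> T then y S * y T / (\<Prod>p\<in>U. h p) else 0)"
      using finite_F by (simp add: sum.inter_filter)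
  qed
  also have "\<dots> = (\<Sum>U\<in>F. \<Sum>S\<in>F. \<Sum>T\<in>F. if U \<subseteq> S \<and> U \<subseteq> T then y S * y T / (\<Prod>p\<in>U. h p) else 0)"
    by (subst (2) sum.swap, subst sum.swap) simp
  also have "\<dots> = (\<Sum>U\<in>F. (\<Sum>S | S \<in> F \<and> U \<subseteq> S. y S)\<^sup>2 / (\<Prod>p\<in>U. h p))"
  proof (intro sum.cong refl)
    fix U assume "U \<in> F"
    have "(\<Sum>S | S \<in> F \<and> U \<subseteq> S. y S)\<^sup>2 / (\<Prod>p\<in>U. h p)
       = (\<Sum>S\<in>F. \<Sum>T\<in>F. (if U \<subseteq> S then y S else 0) * (if U \<subseteq> T then y T else 0) / (\<Prod>p\<in>U. h p))"
      using finite_F by (simp add: sum.inter_filter power2_eq_square sum_product sum_divide_distrib)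
    then show "(\<Sum>S\<in>F. \<Sum>T\<in>F. if U \<subseteq> S \<and> U \<subseteq> T then y S * y T / (\<Prod>p\<in>U. h p) else 0)
       = (\<Sum>S | S \<in> F \<and> U \<subseteq> S. y S)\<^sup>2 / (\<Prod>p\<in>U. h p)"
      by (auto intro!: sum.cong)
  qed
  also have "\<dots> = (\<Sum>U\<in>F. (\<Prod>p\<in>U. h p) / G\<^sup>2)"
    using prod_h_pos unfolding y_def
    by (intro sum.cong refl)
       (simp add: sum_supersets_weight power_mult_distrib power_divide power2_eq_square less_imp_neq[symmetric]
          flip: power_mult_distrib)
  also have "\<dots> = 1 / G"
    using G_pos by (simp add: G_def[symmetric] sum_divide_distrib[symmetric] power2_eq_square)
  finally show ?thesis .
qed

text \<open>
  For each \<open>n\<close>, \<open>B n\<close> is the set of primes that rule \<open>n\<close> out; the elements counted are those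
  which no nonempty member of \<open>F\<close> rules out. For them the sum of the weights over
  \<open>S \<subseteq> B n\<close> has the single term \<open>\<lambda>({}) = 1\<close>, while for all other \<open>n\<close> its square is
  nonnegative. Expanding the square, the main terms add up to the quadratic form and the errors are
  multiplied by weights of absolute value at most 1.
\<close>

theorem selberg_sieve:
  fixes A :: "'n set" and B :: "'n \<Rightarrow> 'p set" and M :: real and E :: "'p set \<Rightarrow> real"
  assumes "finite A"
    and count: "\<And>S T. S \<in> F \<Longrightarrow> T \<in> F \<Longrightarrow>
      \<bar>real (card {n\<in>A. S \<union> T \<subseteq> B n}) - M * (\<Prod>p\<in>S \<union> T. g p)\<bar> \<le> E (S \<union> T)"
  shows "real (card {n\<in>A. \<forall>S\<in>F. S \<subseteq> B n \<longrightarrow> S = {}}) \<le> M / G + (\<Sum>S\<in>F. \<Sum>T\<in>F. E (S \<union> T))"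
proof -
  have "real (card {n\<in>A. \<forall>S\<in>F. S \<subseteq> B n \<longrightarrow> S = {}})
      = (\<Sum>n\<in>{n\<in>A. \<forall>S\<in>F. S \<subseteq> B n \<longrightarrow> S = {}}. (\<Sum>S | S \<in> F \<and> S \<subseteq> B n. weight S)\<^sup>2)"
  proof -
    have "(\<Sum>S | S \<in> F \<and> S \<subseteq> B n. weight S) = 1" if "\<forall>S\<in>F. S \<subseteq> B n \<longrightarrow> S = {}" for n
    proof -
      have "{S. S \<in> F \<and> S \<subseteq> B n} = {{}}" using that empty_mem by auto
      then show ?thesis by (simp add: weight_empty)
    qed
    then show ?thesis by simp
  qed
  also have "\<dots> \<le> (\<Sum>n\<in>A. (\<Sum>S | S \<in> F \<and> S \<subseteq> B n. weight S)\<^sup>2)"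
    using \<open>finite A\<close> by (intro sum_mono2) auto
  also have "\<dots> = (\<Sum>n\<in>A. \<Sum>S\<in>F. \<Sum>T\<in>F. weight S * weight T * (if S \<union> T \<subseteq> B n then 1 else 0))"
    using finite_F
    by (simp add: sum.inter_filter power2_eq_square sum_product) (auto intro!: sum.cong)
  also have "\<dots> = (\<Sum>S\<in>F. \<Sum>T\<in>F. \<Sum>n\<in>A. weight S * weight T * (if S \<union> T \<subseteq> B n then 1 else 0))"
    by (subst sum.swap, intro sum.cong refl, rule sum.swap)
  also have "\<dots> = (\<Sum>S\<in>F. \<Sum>T\<in>F. weight S * weight T * real (card {n\<in>A. S \<union> T \<subseteq> B n}))"
    using \<open>finite A\<close> by (simp add: sum_distrib_left[symmetric] sum.inter_filter[symmetric])
  also have "\<dots> \<le> (\<Sum>S\<in>F. \<Sum>T\<in>F. M * (weight S * weight T * (\<Prod>p\<in>S \<union> T. g p)) + E (S \<union> T))"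
  proof (intro sum_mono)
    fix S T assume S: "S \<in> F" and T: "T \<in> F"
    define c where "c = real (card {n\<in>A. S \<union> T \<subseteq> B n}) - M * (\<Prod>p\<in>S \<union> T. g p)"
    have "weight S * weight T * c \<le> \<bar>weight S\<bar> * \<bar>weight T\<bar> * \<bar>c\<bar>"
      by (metis abs_ge_self abs_mult)
    also have "\<dots> \<le> 1 * 1 * \<bar>c\<bar>"
      using abs_weight_le_1[OF S] abs_weight_le_1[OF T] by (intro mult_mono) auto
    also have "\<dots> \<le> E (S \<union> T)" using count[OF S T] by (simp add: c_def)
    finally show "weight S * weight T * real (card {n\<in>A. S \<union> T \<subseteq> B n})
       \<le> M * (weight S * weight T * (\<Prod>p\<in>S \<union> T. g p)) + E (S \<union> T)"
      by (simp add: c_def algebra_simps)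
  qed
  also have "\<dots> = M * (1 / G) + (\<Sum>S\<in>F. \<Sum>T\<in>F. E (S \<union> T))"
    by (simp add: sum.distrib sum_distrib_left[symmetric] quadratic_form_eq)
  finally show ?thesis by simp
qed

end

section \<open>Residues annihilating a shifted product\<close>

text \<open>
  The Chinese remainder theorem as a counting statement, for predicates that depend only on the
  residue modulo \<open>a\<close> and modulo \<open>b\<close>.
\<close>

lemma card_coprime_moduli:
  fixes P Q :: "nat \<Rightarrow> bool"
  assumes cop: "coprime a b" and pos: "a > 0" "b > 0"
    and P: "\<And>n. P (n mod a) \<longleftrightarrow> P n" and Q: "\<And>n. Q (n mod b) \<longleftrightarrow> Q n"
  shows "card {n. n < a * b \<and> P n \<and> Q n} = card {n. n < a \<and> P n} * card {n. n < b \<and> Q n}"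
proof -
  have "bij_betw (\<lambda>n. (n mod a, n mod b)) {n. n < a * b \<and> P n \<and> Q n}
          ({n. n < a \<and> P n} \<times> {n. n < b \<and> Q n})"
    unfolding bij_betw_def
  proof
    show "inj_on (\<lambda>n. (n mod a, n mod b)) {n. n < a * b \<and> P n \<and> Q n}"
    proof (rule inj_onI)
      fix x y
      assume xy: "x \<in> {n. n < a * b \<and> P n \<and> Q n}" "y \<in> {n. n < a * b \<and> P n \<and> Q n}"
        "(x mod a, x mod b) = (y mod a, y mod b)"
      have "\<exists>!z. z < a * b \<and> [z = x] (mod a) \<and> [z = x] (mod b)"
        using cop pos by (intro binary_chinese_remainder_unique_nat) auto
      moreover have "x < a * b \<and> [x = x] (mod a) \<and> [x = x] (mod b)"
        "y < a * b \<and> [y = x] (mod a) \<and> [y = x] (mod b)"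
        using xy by (simp_all add: cong_def)
      ultimately show "x = y" by blast
    qed
    show "(\<lambda>n. (n mod a, n mod b)) ` {n. n < a * b \<and> P n \<and> Q n}
        = {n. n < a \<and> P n} \<times> {n. n < b \<and> Q n}"
    proof safe
      fix u v assume uv: "u < a" "P u" "v < b" "Q v"
      obtain x where x: "x < a * b" "[x = u] (mod a)" "[x = v] (mod b)"
        using pos ex1_implies_ex[OF binary_chinese_remainder_unique_nat[OF cop, of u v]] by (metis less_not_refl)
      then have m: "x mod a = u" "x mod b = v" using uv by (simp_all add: cong_def)
      then have "P x" "Q x" using uv P[of x] Q[of x] by simp_all
      then show "(u, v) \<in> (\<lambda>n. (n mod a, n mod b)) ` {n. n < a * b \<and> P n \<and> Q n}"
        using x m by (auto simp: image_iff intro!: exI[of _ x])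
    qed (simp_all add: pos P Q)
  qed
  then show ?thesis by (simp add: bij_betw_same_card card_cartesian_product)
qed

text \<open>
  Complete periods contribute exactly, and the incomplete last one contributes at most as much as a
  complete one, both to the count and to its expected value.
\<close>

lemma card_periodic_initial_segment:
  fixes P :: "nat \<Rightarrow> bool" and m N :: nat
  assumes m: "m > 0" and P: "\<And>n. P (n mod m) \<longleftrightarrow> P n"
  shows "\<bar>real (card {n. n < N \<and> P n}) - real N * (card {n. n < m \<and> P n} / real m)\<bar>
           \<le> real (card {n. n < m \<and> P n})"
proof -
  define c where "c = card {n. n < m \<and> P n}"
  have blocks: "card {n. n < m * q + t \<and> P n} = q * c + card {n. n < t \<and> P n}" for q t
  proof (induction q)
    case (Suc q)
    have shift: "P (n + m) \<longleftrightarrow> P n" for n by (metis P mod_add_self2)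
    have "{n. n < m * Suc q + t \<and> P n}
        = {n. n < m \<and> P n} \<union> (\<lambda>n. n + m) ` {n. n < m * q + t \<and> P n}"
    proof (intro equalityI subsetI)
      fix n assume n: "n \<in> {n. n < m * Suc q + t \<and> P n}"
      show "n \<in> {n. n < m \<and> P n} \<union> (\<lambda>n. n + m) ` {n. n < m * q + t \<and> P n}"
      proof (cases "n < m")
        case False
        then have eq: "n = (n - m) + m" and "n - m < m * q + t" using n by auto
        moreover have "P (n - m)" using n shift[of "n - m"] eq by simp
        ultimately show ?thesis by (intro UnI2 image_eqI[of _ _ "n - m"]) auto
      qed (use n in simp)
    qed (use shift in auto)
    moreover have "{n. n < m \<and> P n} \<inter> (\<lambda>n. n + m) ` {n. n < m * q + t \<and> P n} = {}" by auto
    ultimately show ?case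
      using Suc by (simp add: card_Un_disjoint card_image c_def)
  qed simp
  have N: "N = m * (N div m) + N mod m" by simp
  have count: "card {n. n < N \<and> P n} = (N div m) * c + card {n. n < N mod m \<and> P n}"
    by (subst N, rule blocks)
  have le: "card {n. n < N mod m \<and> P n} \<le> c"
    unfolding c_def using m by (intro card_mono) (auto intro: less_trans)
  have "real N = real m * real (N div m) + real (N mod m)"
    by (subst N) (simp only: of_nat_add of_nat_mult)
  then have "real N * (c / real m) = real (N div m) * c + real (N mod m) / real m * c"
    using m by (simp add: field_simps)
  moreover have "real (N mod m) / real m \<le> 1" using m by (simp add: less_imp_le)
  then have "0 \<le> real (N mod m) / real m * c" "real (N mod m) / real m * c \<le> 1 * c"
    using mult_right_mono[of "real (N mod m) / real m" 1 "real c"] by simp_all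
  moreover have "real (card {n. n < N mod m \<and> P n}) \<le> real c" using le by simp
  ultimately show ?thesis
    unfolding c_def[symmetric] count of_nat_add of_nat_mult abs_le_iff by linarith
qed

definition roots :: "nat \<Rightarrow> nat \<Rightarrow> nat" where
  "roots d p = (if p dvd d then 1 else 2)"

text \<open>
  The roots of \<open>n (n + d)\<close> modulo \<open>p\<close> are \<open>0\<close> and \<open>-d\<close>, which coincide exactly when \<open>p\<close> divides
  \<open>d\<close>.
\<close>

lemma card_roots_prime:
  assumes "prime p"
  shows "card {n. n < p \<and> p dvd n * (n + d)} = roots d p"
proof -
  have p: "p > 0" using assms prime_gt_0_nat by blast
  define r where "r = (p - d mod p) mod p"
  have dp: "d mod p < p" using p by simp
  have "p dvd n + d \<longleftrightarrow> n = r" if "n < p" for n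
  proof -
    have "p dvd n + d \<longleftrightarrow> p dvd n + d mod p"
      by (simp add: dvd_eq_mod_eq_0 mod_add_right_eq)
    also have "p dvd n + d mod p \<longleftrightarrow> n = r"
    proof (cases "d mod p = 0")
      case True
      then show ?thesis using that p by (auto simp: r_def dest: dvd_imp_le)
    next
      case False
      have r: "r = p - d mod p" using False dp by (simp add: r_def)
      have "p dvd n + d mod p \<longleftrightarrow> n + d mod p = p"
      proof
        assume "p dvd n + d mod p"
        then obtain k where k: "n + d mod p = p * k" by (auto elim: dvdE)
        have "0 < p * k" "p * k < p * 2" using k False that dp by linarith+
        then have "k = 1" by (cases k) auto
        then show "n + d mod p = p" using k by simp
      qed simp
      then show ?thesis using r dp by auto
    qed
    finally show ?thesis .
  qed
  moreover have "r < p" using p by (simp add: r_def)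
  moreover have "p dvd n \<longleftrightarrow> n = 0" if "n < p" for n
    using that by (auto dest: dvd_imp_le)
  ultimately have "{n. n < p \<and> p dvd n * (n + d)} = {0, r}"
    using assms p by (auto simp: prime_dvd_mult_iff)
  moreover have "r = 0 \<longleftrightarrow> p dvd d"
    using p dp by (cases "d mod p = 0") (auto simp: r_def dvd_eq_mod_eq_0)
  ultimately show ?thesis by (simp add: roots_def card_insert_if)
qed

lemma dvd_shifted_product_periodic:
  fixes p m :: nat
  assumes "p dvd m"
  shows "p dvd (n mod m) * (n mod m + d) \<longleftrightarrow> p dvd n * (n + d)"
proof -
  have "[n mod m * (n mod m + d) = n * (n + d)] (mod m)"
    by (intro cong_mult cong_add) (simp_all add: cong_def)
  then have "[n mod m * (n mod m + d) = n * (n + d)] (mod p)"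
    using assms by (rule cong_dvd_modulus_nat)
  then show ?thesis by (rule cong_dvd_iff)
qed

lemma card_roots_prod:
  assumes "finite U" "\<And>p. p \<in> U \<Longrightarrow> prime p"
  shows "card {n. n < \<Prod>U \<and> (\<forall>p\<in>U. p dvd n * (n + d))} = (\<Prod>p\<in>U. roots d p)"
  using assms
proof (induction U rule: finite_induct)
  case (insert q U)
  have q: "prime q" using insert by auto
  have cop: "coprime q (\<Prod>U)"
    using insert q by (intro prod_coprime_right) (metis insert_iff primes_coprime)
  have "card {n. n < \<Prod>(insert q U) \<and> (\<forall>p\<in>insert q U. p dvd n * (n + d))}
      = card {n. n < q * \<Prod>U \<and> q dvd n * (n + d) \<and> (\<forall>p\<in>U. p dvd n * (n + d))}"
    using insert by simp
  also have "\<dots> = card {n. n < q \<and> q dvd n * (n + d)}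
      * card {n. n < \<Prod>U \<and> (\<forall>p\<in>U. p dvd n * (n + d))}"
  proof (rule card_coprime_moduli[OF cop])
    show "0 < q" using q prime_gt_0_nat by blast
    show "0 < \<Prod>U" using insert prime_gt_0_nat by (intro prod_pos) auto
    show "(\<forall>p\<in>U. p dvd n mod \<Prod>U * (n mod \<Prod>U + d)) \<longleftrightarrow> (\<forall>p\<in>U. p dvd n * (n + d))" for n
      using insert by (intro ball_cong refl dvd_shifted_product_periodic) (auto intro: dvd_prodI)
  qed (simp add: dvd_shifted_product_periodic)
  also have "\<dots> = (\<Prod>p\<in>insert q U. roots d p)"
    using insert by (simp add: card_roots_prime[OF q])
  finally show ?case .
qed simp

lemma card_dvd_shifted_product:
  assumes "finite U" and prime: "\<And>p. p \<in> U \<Longrightarrow> prime p"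
  shows "\<bar>real (card {n. n < N \<and> (\<forall>p\<in>U. p dvd n * (n + d))}) - real N * (\<Prod>p\<in>U. roots d p / p)\<bar>
           \<le> real (\<Prod>U)"
proof -
  have pos: "\<Prod>U > 0" using prime prime_gt_0_nat by (intro prod_pos) auto
  define R where "R = card {n. n < \<Prod>U \<and> (\<forall>p\<in>U. p dvd n * (n + d))}"
  have "\<bar>real (card {n. n < N \<and> (\<forall>p\<in>U. p dvd n * (n + d))}) - real N * (R / real (\<Prod>U))\<bar> \<le> R"
    unfolding R_def using pos assms
    by (intro card_periodic_initial_segment)
       (auto intro!: ball_cong dvd_shifted_product_periodic dvd_prodI)
  moreover have eq: "R / real (\<Prod>U) = (\<Prod>p\<in>U. roots d p / p)"
    using card_roots_prod[OF assms] by (simp add: R_def prod_dividef)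
  moreover have "R \<le> card {..<\<Prod>U}"
    unfolding R_def by (intro card_mono) auto
  then have "real R \<le> real (\<Prod>U)" unfolding of_nat_le_iff by simp
  ultimately show ?thesis unfolding eq by linarith
qed

section \<open>Lower bound for the sieve sum\<close>

text \<open>
  The squarefree integers in \<open>{1..R}\<close>, given by their sets of prime factors.
\<close>

definition prime_sets :: "nat \<Rightarrow> nat set set" where
  "prime_sets R = {S. finite S \<and> (\<forall>p\<in>S. prime p) \<and> \<Prod>S \<le> R}"

lemma prime_setsD:
  assumes "S \<in> prime_sets R"
  shows "finite S" "\<And>p. p \<in> S \<Longrightarrow> prime p" "\<Prod>S \<le> R" "\<Prod>S > 0"
proof -
  show *: "finite S" "\<And>p. p \<in> S \<Longrightarrow> prime p" "\<Prod>S \<le> R"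
    using assms by (auto simp: prime_sets_def)
  show "\<Prod>S > 0" using * prime_gt_0_nat by (intro prod_pos) auto
qed

lemma prime_factors_prod_primes:
  fixes S :: "nat set"
  assumes "finite S" "\<And>p. p \<in> S \<Longrightarrow> prime p"
  shows "prime_factors (\<Prod>S) = S"
proof -
  have "0 \<notin> S" using assms(2) not_prime_0 by blast
  then have "\<Prod>S \<noteq> 0" using assms(1) by simp
  moreover have "q dvd \<Prod>S \<longleftrightarrow> q \<in> S" if "prime q" for q
    using that assms by (metis dvd_refl prime_dvd_prod_iff primes_dvd_imp_eq)
  ultimately show ?thesis using assms(2) by (auto simp: prime_factors_dvd)
qed

lemma prime_sets_subset:
  assumes S: "S \<in> prime_sets R" and T: "T \<subseteq> S" 
  shows "T \<in> prime_sets R"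
proof -
  have "\<Prod>T dvd \<Prod>S" using prime_setsD[OF S] T by (intro prod_dvd_prod_subset) auto
  then have "\<Prod>T \<le> \<Prod>S" using prime_setsD[OF S] by (intro dvd_imp_le)
  then show ?thesis using prime_setsD[OF S] T by (auto simp: prime_sets_def intro: finite_subset)
qed

lemma inj_on_prod_prime_sets: "inj_on (\<lambda>S. \<Prod>S) (prime_sets R)"
proof (rule inj_onI)
  fix S T assume S: "S \<in> prime_sets R" and T: "T \<in> prime_sets R" and eq: "\<Prod>S = \<Prod>T"
  have "S = prime_factors (\<Prod>S)"
    by (rule prime_factors_prod_primes[OF prime_setsD(1,2)[OF S], symmetric])
  also have "\<dots> = T"
    unfolding eq by (rule prime_factors_prod_primes[OF prime_setsD(1,2)[OF T]])
  finally show "S = T" .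
qed

lemma prod_prime_sets_image: "(\<lambda>S. \<Prod>S) ` prime_sets R \<subseteq> {1..R}"
proof
  fix n assume "n \<in> (\<lambda>S. \<Prod>S) ` prime_sets R"
  then obtain S where "S \<in> prime_sets R" "n = \<Prod>S" by (rule imageE)
  then show "n \<in> {1..R}" using prime_setsD(3,4)[of S R] by simp
qed

lemma finite_prime_sets: "finite (prime_sets R)"
  by (rule inj_on_finite[OF inj_on_prod_prime_sets prod_prime_sets_image finite_atLeastAtMost])

lemma card_prime_sets_le: "card (prime_sets R) \<le> R"
  using card_inj_on_le[OF inj_on_prod_prime_sets prod_prime_sets_image finite_atLeastAtMost]
  unfolding card_atLeastAtMost by simp

lemma empty_in_prime_sets: "R \<ge> 1 \<Longrightarrow> {} \<in> prime_sets R"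
  by (simp add: prime_sets_def)

lemma sum_inverse_squares_le: "(\<Sum>k=1..n. 1 / (real k)\<^sup>2) \<le> 2"
proof -
  have "(\<Sum>k=1..n. 1 / (real k)\<^sup>2) \<le> 2 - 1 / real n" if "n \<ge> 1" for n
    using that
  proof (induction n rule: dec_induct)
    case (step n)
    have "1 / (real (Suc n))\<^sup>2 \<le> 1 / (real n * real (Suc n))"
      unfolding power2_eq_square using step by (intro divide_left_mono mult_right_mono) auto
    also have "\<dots> = 1 / real n - 1 / real (Suc n)"
      using step by (simp add: field_simps)
    finally have "1 / (real (Suc n))\<^sup>2 \<le> 1 / real n - 1 / real (Suc n)" .
    then show ?case using step by simp
  qed simp
  from this[of n] show ?thesis by (cases "n \<ge> 1") (auto intro: order_trans)
qed

lemma sum_prime_sets_le_sum: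
  fixes f :: "nat \<Rightarrow> real"
  assumes "\<And>n. f n \<ge> 0"
  shows "(\<Sum>S\<in>prime_sets R. f (\<Prod>S)) \<le> (\<Sum>n=1..R. f n)"
proof -
  have "(\<Sum>S\<in>prime_sets R. f (\<Prod>S)) = (\<Sum>n\<in>(\<lambda>S. \<Prod>S) ` prime_sets R. f n)"
    by (simp add: sum.reindex[OF inj_on_prod_prime_sets])
  also have "\<dots> \<le> (\<Sum>n=1..R. f n)"
    using prod_prime_sets_image assms by (intro sum_mono2) auto
  finally show ?thesis .
qed

text \<open>
  Every integer is a squarefree number times a square, so the harmonic sum is at most the sum of
  \<open>1 / s\<close> over squarefree \<open>s\<close> times the convergent sum of \<open>1 / k^2\<close>.
\<close>

lemma harm_le_sum_prime_sets:
  "(\<Sum>n=1..y. 1 / real n) \<le> 2 * (\<Sum>S\<in>prime_sets y. 1 / real (\<Prod>S))"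
proof -
  have "(\<Sum>n=1..y. 1 / real n)
     \<le> (\<Sum>x\<in>prime_sets y \<times> {1..y}. 1 / real (\<Prod>(fst x)) * (1 / (real (snd x))\<^sup>2))"
  proof (rule sum_le_included[where i = "\<lambda>x. \<Prod>(fst x) * (snd x)\<^sup>2"])
    show "\<forall>n\<in>{1..y}. \<exists>x\<in>prime_sets y \<times> {1..y}. \<Prod>(fst x) * (snd x)\<^sup>2 = n
       \<and> 1 / real n \<le> 1 / real (\<Prod>(fst x)) * (1 / (real (snd x))\<^sup>2)"
    proof
      fix n assume n: "n \<in> {1..y}"
      define s where "s = squarefree_part n"
      define k where "k = square_part n"
      have eq: "n = s * k\<^sup>2" using squarefree_decompose[of n] by (simp add: s_def k_def)
      have s: "s > 0" and k: "k > 0" using n eq by (auto intro: Nat.gr0I)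
      have "multiplicity p s = 1" if "p \<in> prime_factors s" for p
        using that prime_multiplicity_squarefree_part_le_Suc_0[of p n]
        by (auto simp: prime_factors_multiplicity s_def)
      then have "(\<Prod>p\<in>prime_factors s. p) = (\<Prod>p\<in>prime_factors s. p ^ multiplicity p s)"
        by (intro prod.cong refl) simp
      then have prod: "\<Prod>(prime_factors s) = s"
        using s by (simp add: prod_prime_factors)
      have "s dvd n" "k dvd n" unfolding eq by (auto simp: power2_eq_square)
      then have "s \<le> y" "k \<le> y" using n by (auto dest!: dvd_imp_le)
      then have "(prime_factors s, k) \<in> prime_sets y \<times> {1..y}"
        using k prod by (auto simp: prime_sets_def Suc_le_eq in_prime_factors_iff)
      moreover have "1 / real n = 1 / real s * (1 / (real k)\<^sup>2)"
        by (subst eq) simp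
      ultimately show "\<exists>x\<in>prime_sets y \<times> {1..y}. \<Prod>(fst x) * (snd x)\<^sup>2 = n
         \<and> 1 / real n \<le> 1 / real (\<Prod>(fst x)) * (1 / (real (snd x))\<^sup>2)"
        using prod eq by (intro bexI[of _ "(prime_factors s, k)"]) auto
    qed
  qed (auto simp: finite_prime_sets intro!: mult_nonneg_nonneg prod_nonneg)
  also have "\<dots> = (\<Sum>S\<in>prime_sets y. 1 / real (\<Prod>S)) * (\<Sum>k=1..y. 1 / (real k)\<^sup>2)"
    by (simp add: sum_product sum.cartesian_product case_prod_beta)
  also have "\<dots> \<le> (\<Sum>S\<in>prime_sets y. 1 / real (\<Prod>S)) * 2"
    by (intro mult_left_mono sum_inverse_squares_le sum_nonneg) (auto intro!: prod_nonneg)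
  finally show ?thesis by simp
qed

text \<open>
  A pair \<open>(S, T)\<close> is determined by its common part \<open>U = S \<inter> T\<close>, the symmetric difference
  \<open>W\<close>, and the part \<open>A = S - T\<close> of \<open>W\<close>. Since \<open>\<Prod>S \<Prod>T = (\<Prod>U)^2 \<Prod>W\<close>, the sum over \<open>U\<close>
  converges and the choice of \<open>A\<close> gives the factor \<open>2 ^ card W\<close>.
\<close>

lemma sum_prime_sets_squared_le:
  "(\<Sum>S\<in>prime_sets y. 1 / real (\<Prod>S))\<^sup>2 \<le> 2 * (\<Sum>W\<in>prime_sets (y\<^sup>2). 2 ^ card W / real (\<Prod>W))"
proof -
  define Z where "Z = prime_sets y \<times> Sigma (prime_sets (y\<^sup>2)) Pow"
  define w where "w = (\<lambda>(U :: nat set, W :: nat set, A :: nat set). 1 / (real (\<Prod>U))\<^sup>2 * (1 / real (\<Prod>W)))"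
  have finP: "finite (Pow W)" if "W \<in> prime_sets (y\<^sup>2)" for W
    using prime_setsD[OF that] by simp
  have "(\<Sum>S\<in>prime_sets y. 1 / real (\<Prod>S))\<^sup>2
      = (\<Sum>(S, T)\<in>prime_sets y \<times> prime_sets y. 1 / real (\<Prod>S) * (1 / real (\<Prod>T)))"
    by (simp add: power2_eq_square sum_product sum.cartesian_product)
  also have "\<dots> \<le> (\<Sum>z\<in>Z. w z)"
  proof (rule sum_le_included[where i = "\<lambda>(U, W, A). (A \<union> U, (W - A) \<union> U)"])
    show "finite Z" unfolding Z_def
      using finP by (intro finite_cartesian_product finite_SigmaI finite_prime_sets) auto
    show "\<forall>x\<in>prime_sets y \<times> prime_sets y. \<exists>z\<in>Z. (case z of (U, W, A) \<Rightarrow> (A \<union> U, (W - A) \<union> U)) = x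
       \<and> (case x of (S, T) \<Rightarrow> 1 / real (\<Prod>S) * (1 / real (\<Prod>T))) \<le> w z"
    proof clarify
      fix S T assume S: "S \<in> prime_sets y" and T: "T \<in> prime_sets y"
      define W where "W = (S - T) \<union> (T - S)"
      note D = prime_setsD[OF S] prime_setsD[OF T]
      have U: "S \<inter> T \<in> prime_sets y" using prime_sets_subset[OF S, of "S \<inter> T"] by simp
      have "\<Prod>S = \<Prod>(S - T) * \<Prod>(S \<inter> T)" "\<Prod>T = \<Prod>(T - S) * \<Prod>(S \<inter> T)"
        using prod.Int_Diff[of S "\<lambda>x. x" T] prod.Int_Diff[of T "\<lambda>x. x" S] D
        by (simp_all add: mult.commute Int_commute)
      moreover have "\<Prod>W = \<Prod>(S - T) * \<Prod>(T - S)"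
        unfolding W_def using D by (intro prod.union_disjoint) auto
      ultimately have prod: "\<Prod>S * \<Prod>T = (\<Prod>(S \<inter> T))\<^sup>2 * \<Prod>W"
        by (simp add: power2_eq_square mult_ac)
      have "\<Prod>W dvd \<Prod>S * \<Prod>T" unfolding prod by simp
      then have "\<Prod>W \<le> \<Prod>S * \<Prod>T" using D by (intro dvd_imp_le) auto
      also have "\<dots> \<le> y\<^sup>2" using D by (simp add: power2_eq_square mult_le_mono)
      finally have W: "W \<in> prime_sets (y\<^sup>2)" using D by (auto simp: prime_sets_def W_def)
      have "real (\<Prod>S) * real (\<Prod>T) = (real (\<Prod>(S \<inter> T)))\<^sup>2 * real (\<Prod>W)"
        using arg_cong[OF prod, of real] by (simp only: of_nat_mult of_nat_power)
      then have "1 / real (\<Prod>S) * (1 / real (\<Prod>T)) = w (S \<inter> T, W, S - T)"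
        by (simp add: w_def)
      moreover have "(S \<inter> T, W, S - T) \<in> Z" using U W by (auto simp: Z_def W_def)
      moreover have "(S - T) \<union> S \<inter> T = S" "(W - (S - T)) \<union> S \<inter> T = T"
        by (auto simp: W_def)
      ultimately show "\<exists>z\<in>Z. (case z of (U, W, A) \<Rightarrow> (A \<union> U, (W - A) \<union> U)) = (S, T)
         \<and> 1 / real (\<Prod>S) * (1 / real (\<Prod>T)) \<le> w z"
        by (intro bexI[of _ "(S \<inter> T, W, S - T)"]) auto
    qed
  qed (auto simp: finite_prime_sets w_def intro!: mult_nonneg_nonneg prod_nonneg)
  also have "\<dots> = (\<Sum>U\<in>prime_sets y. 1 / (real (\<Prod>U))\<^sup>2)
      * (\<Sum>x\<in>Sigma (prime_sets (y\<^sup>2)) Pow. 1 / real (\<Prod>(fst x)))"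
    by (simp add: Z_def w_def sum_product sum.cartesian_product case_prod_beta)
  also have "(\<Sum>x\<in>Sigma (prime_sets (y\<^sup>2)) Pow. 1 / real (\<Prod>(fst x)))
      = (\<Sum>W\<in>prime_sets (y\<^sup>2). \<Sum>A\<in>Pow W. 1 / real (\<Prod>W))"
    using finP by (subst sum.Sigma) (auto simp: finite_prime_sets case_prod_beta)
  also have "\<dots> = (\<Sum>W\<in>prime_sets (y\<^sup>2). 2 ^ card W / real (\<Prod>W))"
    using prime_setsD by (intro sum.cong refl) (simp add: card_Pow)
  also have "(\<Sum>U\<in>prime_sets y. 1 / (real (\<Prod>U))\<^sup>2) * (\<Sum>W\<in>prime_sets (y\<^sup>2). 2 ^ card W / real (\<Prod>W))
      \<le> 2 * (\<Sum>W\<in>prime_sets (y\<^sup>2). 2 ^ card W / real (\<Prod>W))"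
    using sum_prime_sets_le_sum[of "\<lambda>n. 1 / (real n)\<^sup>2" y] sum_inverse_squares_le[of y]
    by (intro mult_right_mono sum_nonneg) (auto intro!: divide_nonneg_nonneg prod_nonneg)
  finally show ?thesis .
qed

text \<open>
  Up to bounded factors, the dependence on \<open>d\<close> of the singular series for pairs of primes with
  difference \<open>d\<close>; it equals \<open>\<sigma>(d) / d\<close> when \<open>d\<close> is squarefree.
\<close>

definition singular_factor :: "nat \<Rightarrow> real" where
  "singular_factor d = (\<Prod>p\<in>prime_factors d. 1 + 1 / real p)"

lemma singular_factor_eq: "singular_factor d = (\<Sum>C\<in>Pow (prime_factors d). 1 / real (\<Prod>C))"
  unfolding singular_factor_def by (subst prod_one_plus_eq_sum_Pow) (simp_all add: prod_dividef)

text \<open>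
  The density of the sieve is \<open>2 / p\<close> at primes not dividing \<open>d\<close> but only \<open>1 / p\<close> at the divisors
  of \<open>d\<close>. Writing the missing factor \<open>2\<close> at each \<open>p \<in> W\<close> dividing \<open>d\<close> as a choice of whether
  \<open>p\<close> belongs to a set \<open>C\<close>, and pulling \<open>C\<close> out of \<open>W\<close>, costs at most \<open>\<Sum>1 / \<Prod>C\<close> over sets
  \<open>C\<close> of prime divisors of \<open>d\<close>.
\<close>

lemma sum_two_power_le_singular_factor:
  assumes d: "d > 0"
  shows "(\<Sum>W\<in>prime_sets R. 2 ^ card W / real (\<Prod>W))
    \<le> singular_factor d * (\<Sum>W\<in>prime_sets R. \<Prod>p\<in>W. roots d p / p)"
proof -
  define D where "D = prime_factors d"
  define g where "g p = roots d p / real p" for p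
  have D: "p \<in> D \<longleftrightarrow> p dvd d" if "prime p" for p
    using that d by (auto simp: D_def prime_factors_dvd)
  have fD: "finite D" by (simp add: D_def)
  have expand: "2 ^ card W / real (\<Prod>W) = (\<Sum>C\<in>Pow (W \<inter> D). \<Prod>p\<in>W. g p)"
    if W: "W \<in> prime_sets R" for W
  proof -
    note W' = prime_setsD[OF W]
    have "(2 :: real) ^ card W = (\<Prod>p\<in>W. 2)" by simp
    also have "\<dots> = (\<Prod>p\<in>W. real (roots d p) * (if p \<in> D then 2 else 1))"
      using W'(2) D by (intro prod.cong refl) (auto simp: roots_def)
    also have "\<dots> = (\<Prod>p\<in>W. real (roots d p)) * 2 ^ card (W \<inter> D)"
      using W' by (simp add: prod.distrib prod.If_cases)
    also have "2 ^ card (W \<inter> D) = real (card (Pow (W \<inter> D)))"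
      using card_Pow[of "W \<inter> D"] W' by (simp del: Pow_Int_eq)
    finally show ?thesis
      by (simp add: g_def prod_dividef del: Pow_Int_eq)
  qed
  have "(\<Sum>W\<in>prime_sets R. 2 ^ card W / real (\<Prod>W))
      = (\<Sum>x\<in>Sigma (prime_sets R) (\<lambda>W. Pow (W \<inter> D)). \<Prod>p\<in>fst x. g p)"
  proof -
    have "(\<Sum>W\<in>prime_sets R. 2 ^ card W / real (\<Prod>W))
        = (\<Sum>W\<in>prime_sets R. \<Sum>C\<in>Pow (W \<inter> D). \<Prod>p\<in>W. g p)"
      by (rule sum.cong[OF refl expand])
    also have "\<dots> = (\<Sum>(W, C)\<in>Sigma (prime_sets R) (\<lambda>W. Pow (W \<inter> D)). \<Prod>p\<in>W. g p)"
      using fD by (intro sum.Sigma finite_prime_sets ballI) (rule finite_Pow_iff[THEN iffD2], rule finite_Int, rule disjI2)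
    finally show ?thesis by (simp only: case_prod_unfold)
  qed
  also have "\<dots> \<le> (\<Sum>x\<in>Pow D \<times> prime_sets R. 1 / real (\<Prod>(fst x)) * (\<Prod>p\<in>snd x. g p))"
  proof (rule sum_le_included[where i = "\<lambda>(C, V). (C \<union> V, C)"])
    show "\<forall>x\<in>Sigma (prime_sets R) (\<lambda>W. Pow (W \<inter> D)). \<exists>z\<in>Pow D \<times> prime_sets R.
       (case z of (C, V) \<Rightarrow> (C \<union> V, C)) = x
       \<and> (\<Prod>p\<in>fst x. g p) \<le> 1 / real (\<Prod>(fst z)) * (\<Prod>p\<in>snd z. g p)"
    proof
      fix x assume "x \<in> Sigma (prime_sets R) (\<lambda>W. Pow (W \<inter> D))"
      then obtain W C where x: "x = (W, C)" and W: "W \<in> prime_sets R" and "C \<in> Pow (W \<inter> D)"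
        by (rule SigmaE)
      then have C: "C \<subseteq> W \<inter> D" by (simp only: Pow_iff)
      note W' = prime_setsD[OF W]
      have roots_C: "g p = 1 / real p" if "p \<in> C" for p
        using that C D[of p] W'(2)[of p] by (auto simp: g_def roots_def)
      have "(\<Prod>p\<in>W. g p) = (\<Prod>p\<in>W - C. g p) * (\<Prod>p\<in>C. g p)"
        using W' C by (intro prod.subset_diff) auto
      also have "(\<Prod>p\<in>C. g p) = (\<Prod>p\<in>C. 1 / real p)"
        by (intro prod.cong refl roots_C)
      finally have eq: "(\<Prod>p\<in>W. g p) = 1 / real (\<Prod>C) * (\<Prod>p\<in>W - C. g p)"
        by (simp add: prod_dividef)
      have "(C, W - C) \<in> Pow D \<times> prime_sets R"
        using prime_sets_subset[OF W, of "W - C"] C by simp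
      moreover have "(C \<union> (W - C), C) = x" using C x by auto
      ultimately show "\<exists>z\<in>Pow D \<times> prime_sets R. (case z of (C, V) \<Rightarrow> (C \<union> V, C)) = x
       \<and> (\<Prod>p\<in>fst x. g p) \<le> 1 / real (\<Prod>(fst z)) * (\<Prod>p\<in>snd z. g p)"
        unfolding x by (intro bexI[of _ "(C, W - C)"] conjI) (simp_all only: prod.case fst_conv snd_conv eq order_refl)
    qed
  qed (use fD in \<open>auto simp: finite_prime_sets g_def intro!: finite_SigmaI prod_nonneg mult_nonneg_nonneg divide_nonneg_nonneg\<close>)
  also have "\<dots> = singular_factor d * (\<Sum>W\<in>prime_sets R. \<Prod>p\<in>W. g p)"
    unfolding singular_factor_eq D_def[symmetric] sum_product sum.cartesian_product case_prod_unfold ..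
  finally show ?thesis by (simp add: g_def)
qed

text \<open>
  The sieve has dimension two: its sum over moduli up to \<open>y^2\<close> dominates the square of the
  harmonic sum up to \<open>y\<close>, apart from a factor depending on \<open>d\<close>.
\<close>

lemma ln_squared_le_sieve_sum:
  assumes "d > 0"
  shows "(ln (real y + 1))\<^sup>2 \<le> 8 * singular_factor d * (\<Sum>W\<in>prime_sets (y\<^sup>2). \<Prod>p\<in>W. roots d p / p)"
proof -
  define H where "H = (\<Sum>S\<in>prime_sets y. 1 / real (\<Prod>S))"
  have "ln (real y + 1) \<le> (\<Sum>n=1..y. 1 / real n)"
    using ln_le_harm[of y] by (simp add: harm_def inverse_eq_divide)
  also have "\<dots> \<le> 2 * H" unfolding H_def by (rule harm_le_sum_prime_sets)
  finally have "(ln (real y + 1))\<^sup>2 \<le> (2 * H)\<^sup>2" by (intro power_mono) auto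
  also have "\<dots> = 4 * H\<^sup>2" by (simp add: power_mult_distrib)
  finally have "(ln (real y + 1))\<^sup>2 \<le> 4 * H\<^sup>2" .
  moreover have "H\<^sup>2 \<le> 2 * (\<Sum>W\<in>prime_sets (y\<^sup>2). 2 ^ card W / real (\<Prod>W))"
    unfolding H_def by (rule sum_prime_sets_squared_le)
  moreover have "(\<Sum>W\<in>prime_sets (y\<^sup>2). 2 ^ card W / real (\<Prod>W))
      \<le> singular_factor d * (\<Sum>W\<in>prime_sets (y\<^sup>2). \<Prod>p\<in>W. roots d p / p)"
    using assms by (rule sum_two_power_le_singular_factor)
  ultimately show ?thesis by linarith
qed

text \<open>
  \<open>f(d)\<close> is at most the sum of \<open>1 / e\<close> over the divisors \<open>e\<close> of \<open>d\<close>, and each \<open>e\<close> divides at most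
  \<open>D / e\<close> of the integers up to \<open>D\<close>.
\<close>

lemma sum_singular_factor_le: "(\<Sum>d=1..D. singular_factor d) \<le> 2 * real D"
proof -
  have le: "singular_factor d \<le> (\<Sum>e\<in>{e\<in>{1..D}. e dvd d}. 1 / real e)" if d: "d \<in> {1..D}" for d
    unfolding singular_factor_eq
  proof (rule sum_le_included[where i = prime_factors])
    show "\<forall>C\<in>Pow (prime_factors d). \<exists>e\<in>{e\<in>{1..D}. e dvd d}. prime_factors e = C \<and> 1 / real (\<Prod>C) \<le> 1 / real e"
    proof
      fix C assume C: "C \<in> Pow (prime_factors d)"
      then have C': "finite C" "\<And>p. p \<in> C \<Longrightarrow> prime p" by (auto intro: finite_subset)
      have "\<Prod>C dvd \<Prod>(prime_factors d)" using C by (intro prod_dvd_prod_subset) auto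
      also have "\<Prod>(prime_factors d) dvd (\<Prod>p\<in>prime_factors d. p ^ multiplicity p d)"
        by (intro prod_dvd_prod dvd_power) (auto simp: prime_factors_multiplicity)
      also have "\<dots> = d" using d by (subst prod_prime_factors) auto
      finally have dvd: "\<Prod>C dvd d" .
      then have "\<Prod>C \<le> d" "\<Prod>C > 0" using d C' prime_gt_0_nat by (auto intro: dvd_imp_le prod_pos)
      then show "\<exists>e\<in>{e\<in>{1..D}. e dvd d}. prime_factors e = C \<and> 1 / real (\<Prod>C) \<le> 1 / real e"
        using prime_factors_prod_primes[OF C'] dvd d by (intro bexI[of _ "\<Prod>C"]) auto
    qed
  qed auto
  have card: "real (card {d\<in>{1..D}. e dvd d}) \<le> real D / real e" if "e \<in> {1..D}" for e
  proof -
    have "{d\<in>{1..D}. e dvd d} \<subseteq> (\<lambda>k. e * k) ` {1..D div e}"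
    proof
      fix d assume d: "d \<in> {d\<in>{1..D}. e dvd d}"
      then have eq: "d = e * (d div e)" by simp
      have "d div e \<noteq> 0" using d eq by (intro notI) simp
      moreover have "d div e \<le> D div e" using d by (intro div_le_mono) simp
      ultimately show "d \<in> (\<lambda>k. e * k) ` {1..D div e}"
        using eq by (intro image_eqI[of _ _ "d div e"]) simp_all
    qed
    then have "card {d\<in>{1..D}. e dvd d} \<le> card ((\<lambda>k. e * k) ` {1..D div e})"
      by (intro card_mono) auto
    also have "\<dots> \<le> D div e" using card_image_le[of "{1..D div e}" "(*) e"] by simp
    finally have "card {d\<in>{1..D}. e dvd d} \<le> D div e" .
    then have "real (card {d\<in>{1..D}. e dvd d}) \<le> real (D div e)" by simp
    also have "\<dots> \<le> real D / real e" by (rule of_nat_div_le_of_nat)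
    finally show ?thesis .
  qed
  have "(\<Sum>d=1..D. singular_factor d) \<le> (\<Sum>d\<in>{1..D}. \<Sum>e\<in>{e\<in>{1..D}. e dvd d}. 1 / real e)"
    by (intro sum_mono le)
  also have "\<dots> = (\<Sum>e\<in>{1..D}. \<Sum>d\<in>{d\<in>{1..D}. e dvd d}. 1 / real e)"
    by (rule sum.swap_restrict) auto
  also have "\<dots> = (\<Sum>e\<in>{1..D}. real (card {d\<in>{1..D}. e dvd d}) / real e)" by simp
  also have "\<dots> \<le> (\<Sum>e\<in>{1..D}. real D * (1 / (real e)\<^sup>2))"
    using card by (intro sum_mono) (auto simp: field_simps power2_eq_square)
  also have "\<dots> \<le> real D * 2"
    unfolding sum_distrib_left[symmetric] by (intro mult_left_mono sum_inverse_squares_le) auto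
  finally show ?thesis by simp
qed

section \<open>Chebyshev's lower bound for the number of primes\<close>

text \<open>
  Leibniz's harmonic triangle: the numbers \<open>u(n, k) = 1 / (k (n choose k))\<close> satisfy
  \<open>u(n, k + 1) = u(n - 1, k) - u(n, k)\<close> and start from \<open>u(n, 1) = 1 / n\<close>, so
  \<open>Lcm {1..n} * u(n, k)\<close> is an integer by induction on \<open>k\<close>. The induction is carried out with
  \<open>a\<close>, \<open>b\<close>, \<open>c\<close> the reciprocals of the three entries.
\<close>

lemma mult_binomial_dvd_Lcm:
  assumes "1 \<le> k" "k \<le> n"
  shows "k * (n choose k) dvd Lcm {1..n}"
  using assms
proof (induction k arbitrary: n rule: dec_induct)
  case base
  then show ?case by (auto intro: dvd_Lcm)
next
  case (step k)
  define L where "L = int (Lcm {1..n})"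
  define a where "a = int (Suc k * (n choose Suc k))"
  define b where "b = int (k * ((n - 1) choose k))"
  define c where "c = int (k * (n choose k))"
  have "k * ((n - 1) choose k) dvd Lcm {1..n - 1}" using step by (intro step.IH) auto
  also have "Lcm {1..n - 1} dvd Lcm {1..n}" by (intro Lcm_subset) auto
  finally have "b dvd L" by (simp only: b_def L_def int_dvd_int_iff)
  then obtain x where x: "L = b * x" by (rule dvdE)
  have "k * (n choose k) dvd Lcm {1..n}" using step by (intro step.IH) auto
  then have "c dvd L" by (simp only: c_def L_def int_dvd_int_iff)
  then obtain y where y: "L = c * y" by (rule dvdE)
  have a_eq: "a = int n * int ((n - 1) choose k)"
    unfolding a_def by (subst binomial_absorption) simp
  have a_eq': "a = (int n - int k) * int (n choose k)"
    using step arg_cong[OF binomial_absorb_comp[of n k], of int] by (simp add: a_eq of_nat_diff)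
  have "int k * a * x = int n * (b * x)" by (simp add: a_eq b_def)
  moreover have "int k * a * y = (int n - int k) * (c * y)" by (simp add: a_eq' c_def)
  ultimately have "int k * (a * (x - y)) = int k * L"
    unfolding x[symmetric] y[symmetric] by (simp add: algebra_simps)
  then have "L = a * (x - y)" using step by simp
  then have "a dvd L" by (rule dvdI)
  then show ?case by (simp only: a_def L_def int_dvd_int_iff)
qed

text \<open>
  The least common multiple contains each prime \<open>p \<le> n\<close> to the largest power not exceeding
  \<open>n\<close>.
\<close>

lemma Lcm_le_power_card_primes:
  fixes n :: nat
  assumes "n \<ge> 1"
  shows "Lcm {1..n} \<le> n ^ card {p. prime p \<and> p \<le> n}"
proof -
  define P where "P = {p::nat. prime p \<and> p \<le> n}"
  define e where "e p = Max {k. p ^ k \<le> n}" for p :: nat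
  have fP: "finite P" by (simp add: P_def)
  have fin: "finite {k. p ^ k \<le> n}" if "p \<in> P" for p
  proof (rule finite_subset)
    have "p > 1" using that prime_gt_1_nat by (auto simp: P_def)
    then have "k \<le> p ^ k" for k using power_gt_expt[of p k] by (simp add: less_imp_le)
    then show "{k. p ^ k \<le> n} \<subseteq> {..n}" by (auto intro: order_trans)
  qed simp
  have "i dvd (\<Prod>p\<in>P. p ^ e p)" if i: "i \<in> {1..n}" for i
  proof -
    have "i = (\<Prod>p\<in>prime_factors i. p ^ multiplicity p i)"
      using i by (subst prod_prime_factors) auto
    also have "\<dots> dvd (\<Prod>p\<in>P. p ^ e p)"
    proof (rule prod_dvd_prod_subset2[OF fP])
      show sub: "prime_factors i \<subseteq> P"
      proof
        fix p assume "p \<in> prime_factors i"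
        then have "prime p" "p dvd i" by auto
        moreover have "p \<le> i" using \<open>p dvd i\<close> i by (intro dvd_imp_le) auto
        ultimately show "p \<in> P" using i by (simp add: P_def)
      qed
      fix p assume p: "p \<in> prime_factors i"
      have "p ^ multiplicity p i \<le> i" using i by (intro dvd_imp_le multiplicity_dvd) auto
      then have "multiplicity p i \<le> e p"
        unfolding e_def using fin sub p i by (intro Max_ge) auto
      then show "p ^ multiplicity p i dvd p ^ e p" by (rule le_imp_power_dvd)
    qed
    finally show ?thesis .
  qed
  then have "Lcm {1..n} dvd (\<Prod>p\<in>P. p ^ e p)" by (rule Lcm_least)
  moreover have "(\<Prod>p\<in>P. p ^ e p) > 0" using prime_gt_0_nat by (intro prod_pos) (auto simp: P_def)
  ultimately have "Lcm {1..n} \<le> (\<Prod>p\<in>P. p ^ e p)" by (rule dvd_imp_le)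
  also have "\<dots> \<le> (\<Prod>p\<in>P. n)"
  proof (intro prod_mono conjI)
    fix p assume p: "p \<in> P"
    have "e p \<in> {k. p ^ k \<le> n}"
      unfolding e_def using fin[OF p] assms by (intro Max_in) (auto intro: exI[of _ 0])
    then show "p ^ e p \<le> n" by simp
  qed simp
  finally show ?thesis by (simp add: P_def)
qed

text \<open>
  The product of \<open>m\<close> and the central binomial coefficient is at least \<open>4 ^ m / 2\<close> and divides
  the least common multiple of \<open>{1..2 m}\<close>, which is at most \<open>(2 m)\<close> to the number of primes up to \<open>2 m\<close>.
\<close>

lemma card_primes_lower_bound:
  assumes m: "m \<ge> 1"
  shows "(2 * real m - 1) * ln 2 \<le> real (card {p. prime p \<and> p \<le> 2 * m}) * ln (2 * real m)"
proof -
  define c where "c = card {p::nat. prime p \<and> p \<le> 2 * m}"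
  have "4 ^ m / 2 = real m * (4 ^ m / (2 * real m))" using m by simp
  also have "\<dots> \<le> real m * real ((2 * m) choose m)"
    using m by (intro mult_left_mono central_binomial_lower_bound) auto
  also have "\<dots> = real (m * ((2 * m) choose m))" by simp
  also have "m * ((2 * m) choose m) \<le> Lcm {1..2 * m}"
    using m by (intro dvd_imp_le mult_binomial_dvd_Lcm) (auto intro!: Nat.gr0I simp: Lcm_0_iff)
  also have "\<dots> \<le> (2 * m) ^ c"
    unfolding c_def using m by (intro Lcm_le_power_card_primes) auto
  finally have "4 ^ m / 2 \<le> (2 * real m) ^ c" by simp
  then have "ln (4 ^ m / 2) \<le> ln ((2 * real m) ^ c)" using m by (subst ln_le_cancel_iff) auto
  also have "ln ((2 * real m) ^ c) = c * ln (2 * real m)" using m by (subst ln_realpow) auto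
  also have "(4 :: real) ^ m = 2 ^ (2 * m)" by (simp add: power_mult)
  then have "ln (4 ^ m / 2 :: real) = (2 * real m - 1) * ln 2"
    by (simp add: ln_div ln_realpow algebra_simps)
  finally show ?thesis by (simp add: c_def)
qed

lemma prime_nth_prime: "prime (nth_prime n)"
  using enumerate_in_set[OF primes_infinite, of "n - 1"] by (simp add: nth_prime_def)

lemma nth_prime_strict_mono: "1 \<le> m \<Longrightarrow> m < n \<Longrightarrow> nth_prime m < nth_prime n"
  unfolding nth_prime_def by (rule enumerate_mono[OF _ primes_infinite]) simp

lemma nth_prime_le:
  assumes n: "1 \<le> n" and card: "n \<le> card {p. prime p \<and> p \<le> M}"
  shows "nth_prime n \<le> M"
proof (rule ccontr)
  assume "\<not> nth_prime n \<le> M"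
  then have gt: "M < enumerate {p::nat. prime p} (n - 1)" by (simp add: nth_prime_def)
  have "{p. prime p \<and> p \<le> M} \<subseteq> enumerate {p. prime p} ` {..<n - 1}"
  proof
    fix p assume p: "p \<in> {p. prime p \<and> p \<le> M}"
    then obtain i where i: "enumerate {p. prime p} i = p"
      using enumerate_Ex[OF primes_infinite, of p] by auto
    then have "enumerate {p. prime p} i < enumerate {p::nat. prime p} (n - 1)" using p gt by simp
    then have "i < n - 1" using enumerate_mono_iff[OF primes_infinite] by blast
    then show "p \<in> enumerate {p. prime p} ` {..<n - 1}" using i by blast
  qed
  then have "card {p. prime p \<and> p \<le> M} \<le> card (enumerate {p::nat. prime p} ` {..<n - 1})"
    by (intro card_mono) auto
  also have "\<dots> \<le> n - 1" using card_image_le[of "{..<n - 1}"] by simp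
  finally show False using n card by simp
qed

text \<open>
  By Chebyshev there are at least \<open>X\<close> primes up to \<open>2 m\<close> as soon as \<open>m\<close> is about \<open>2 X ln X\<close>.
\<close>

lemma eventually_nth_prime_less:
  "\<forall>\<^sub>F X :: real in at_top. \<exists>N::nat. X \<le> real N \<and> real N \<le> 5 * X * ln X \<and>
     (\<forall>n. 1 \<le> n \<and> real n \<le> X \<longrightarrow> nth_prime n < N)"
proof -
  have 1: "\<forall>\<^sub>F X :: real in at_top. X * ln (5 * X * ln X) \<le> (4 * X * ln X - 1) * (2 / 3)"
    by real_asymp
  have 2: "\<forall>\<^sub>F X :: real in at_top. 4 * X * ln X + 3 \<le> 5 * X * ln X" by real_asymp
  have 3: "\<forall>\<^sub>F X :: real in at_top. X \<le> 4 * X * ln X" by real_asymp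
  have 4: "\<forall>\<^sub>F X :: real in at_top. 1 \<le> 2 * X * ln X" by real_asymp
  show ?thesis using 1 2 3 4 eventually_ge_at_top[of 2]
  proof eventually_elim
    case (elim X)
    define m where "m = nat \<lceil>2 * X * ln X\<rceil>"
    have m_ge: "2 * X * ln X \<le> real m" unfolding m_def by linarith
    have m_le: "real m \<le> 2 * X * ln X + 1" unfolding m_def using elim(4) by linarith
    have m1: "m \<ge> 1" using m_ge elim(4) by linarith
    define c where "c = card {p::nat. prime p \<and> p \<le> 2 * m}"
    have lnm: "0 < ln (2 * real m)" using m1 by (intro ln_gt_zero) simp
    have "ln (2 * real m) \<le> ln (5 * X * ln X)"
      using m_le m1 elim by (intro ln_mono) linarith+
    then have "X * ln (2 * real m) \<le> X * ln (5 * X * ln X)"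
      using elim by (intro mult_left_mono) auto
    also have "\<dots> \<le> (4 * X * ln X - 1) * (2 / 3)" by (rule elim(1))
    also have "\<dots> \<le> (2 * real m - 1) * ln 2"
      using m_ge m1 elim(4) ln2_ge_two_thirds by (intro mult_mono) auto
    also have "\<dots> \<le> real c * ln (2 * real m)"
      unfolding c_def using m1 by (rule card_primes_lower_bound)
    finally have "X \<le> real c" using lnm by simp
    have "nth_prime n < 2 * m + 1" if "1 \<le> n" "real n \<le> X" for n
    proof -
      have "n \<le> c" using that \<open>X \<le> real c\<close> by linarith
      then show ?thesis using nth_prime_le[of n "2 * m"] that by (simp add: c_def)
    qed
    moreover have "X \<le> real (2 * m + 1)" using m_ge elim(3) by linarith
    moreover have "real (2 * m + 1) \<le> 5 * X * ln X" using m_le elim by simp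
    ultimately show ?case by blast
  qed
qed

section \<open>Pairs of primes at a given distance\<close>

lemma ln_squared_le_sqrt:
  assumes "x \<ge> (1 :: real)"
  shows "(ln x)\<^sup>2 \<le> 16 * sqrt x"
proof -
  have "ln x = 4 * ln (sqrt (sqrt x))" using assms by (simp add: ln_sqrt)
  also have "\<dots> \<le> 4 * sqrt (sqrt x)"
    using assms ln_le_minus_one[of "sqrt (sqrt x)"] by simp
  finally have "(ln x)\<^sup>2 \<le> (4 * sqrt (sqrt x))\<^sup>2" using assms by (intro power_mono) auto
  then show ?thesis using assms by (simp add: power_mult_distrib)
qed

lemma singular_factor_ge_1: "singular_factor d \<ge> 1"
  unfolding singular_factor_def by (rule prod_ge_1) simp

text \<open>
  Sieving by the primes up to \<open>R = y^2\<close> with moduli up to \<open>R\<close>. If \<open>n > R\<close> and both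
  \<open>n\<close> and \<open>n + d\<close> are prime, then no prime up to \<open>R\<close> divides \<open>n (n + d)\<close>, so \<open>n\<close> survives the
  sieve. There are at most \<open>R^2\<close> pairs of moduli, each with an error of at most \<open>R^2\<close>. Evenness of
  \<open>d\<close> is what keeps the density at \<open>p = 2\<close> below 1: for odd \<open>d\<close> one of \<open>n\<close>, \<open>n + d\<close> is always
  even.
\<close>

lemma card_sifted_prime_pairs:
  assumes d: "d > 0" "even d" and y: "y \<ge> 1"
  defines "g \<equiv> (\<lambda>p. roots d p / real p)"
  shows "real (card {n. n < N \<and> prime n \<and> prime (n + d)})
    \<le> real (y\<^sup>2) + real N / (\<Sum>W\<in>prime_sets (y\<^sup>2). \<Prod>p\<in>W. g p) + real ((y\<^sup>2) ^ 4)"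
proof -
  define R where "R = y\<^sup>2"
  define F where "F = prime_sets R"
  have R: "R \<ge> 1" using y by (simp add: R_def)
  have g: "0 < g p" "g p < 1" if "prime p" for p
  proof -
    have p: "p \<ge> 2" using that prime_ge_2_nat by blast
    then show "0 < g p" by (simp add: g_def roots_def)
    have "roots d p < p"
      using p d by (cases "p = 2") (auto simp: roots_def)
    then show "g p < 1" using p by (simp add: g_def)
  qed
  interpret sieve: selberg_weights F g
  proof
    show "finite F" unfolding F_def by (rule finite_prime_sets)
    show "{} \<in> F" unfolding F_def using R by (rule empty_in_prime_sets)
    fix S assume S: "S \<in> F"
    note S' = prime_setsD[OF S[unfolded F_def]]
    show "finite S" by (rule S')
    show "0 < g p" "g p < 1" if "p \<in> S" for p using g S'(2)[OF that] by auto
  next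
    fix S T assume "T \<in> F" "S \<subseteq> T"
    then show "S \<in> F" unfolding F_def by (rule prime_sets_subset)
  qed
  define B where "B n = {p. prime p \<and> p dvd n * (n + d)}" for n
  define sifted where "sifted = {n\<in>{..<N}. \<forall>S\<in>F. S \<subseteq> B n \<longrightarrow> S = {}}"
  have count: "\<bar>real (card {n\<in>{..<N}. S \<union> T \<subseteq> B n}) - real N * (\<Prod>p\<in>S \<union> T. g p)\<bar> \<le> real R * real R"
    if S: "S \<in> F" and T: "T \<in> F" for S T
  proof -
    note S' = prime_setsD[OF S[unfolded F_def]] and T' = prime_setsD[OF T[unfolded F_def]]
    have ST: "finite (S \<union> T)" "\<And>p. p \<in> S \<union> T \<Longrightarrow> prime p" using S' T' by auto
    have eq: "{n\<in>{..<N}. S \<union> T \<subseteq> B n} = {n. n < N \<and> (\<forall>p\<in>S \<union> T. p dvd n * (n + d))}"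
      using ST(2) by (auto simp: B_def)
    have "\<Prod>(S \<union> T) = \<Prod>S * \<Prod>(T - S)"
      using S' T' prod.union_disjoint[of S "T - S" "\<lambda>x. x"] by simp
    also have "\<Prod>(T - S) dvd \<Prod>T" using T' by (intro prod_dvd_prod_subset) auto
    then have "\<Prod>S * \<Prod>(T - S) \<le> R * R" using S' T' by (intro mult_le_mono) (auto dest: dvd_imp_le)
    finally have "real (\<Prod>(S \<union> T)) \<le> real R * real R" by (simp only: of_nat_mult[symmetric] of_nat_le_iff)
    then show ?thesis
      using card_dvd_shifted_product[OF ST, where N = N and d = d] unfolding eq g_def by linarith
  qed
  have sieve_bound: "real (card sifted) \<le> real N / sieve.G + (\<Sum>S\<in>F. \<Sum>T\<in>F. real R * real R)"
    unfolding sifted_def by (rule sieve.selberg_sieve[OF finite_lessThan count])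
  have "(\<Sum>W\<in>F. \<Prod>p\<in>W. g p) \<le> sieve.G"
    unfolding sieve.G_def
  proof (intro sum_mono prod_mono conjI)
    fix W p assume "W \<in> F" "p \<in> W"
    then have g': "0 < g p" "g p < 1" by (rule sieve.g_pos, rule sieve.g_less_1)
    then show "0 \<le> g p" by simp
    have "g p * (1 - g p) \<le> g p" using g' by (simp add: algebra_simps)
    then show "g p \<le> sieve.h p" using g' by (simp add: sieve.h_def pos_le_divide_eq)
  qed
  moreover have "0 < (\<Sum>W\<in>F. \<Prod>p\<in>W. g p)"
    using sieve.finite_F sieve.empty_mem sieve.prod_g_pos by (intro sum_pos) auto
  ultimately have main: "real N / sieve.G \<le> real N / (\<Sum>W\<in>F. \<Prod>p\<in>W. g p)"
    by (intro divide_left_mono mult_pos_pos) auto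
  have "(\<Sum>S\<in>F. \<Sum>T\<in>F. real R * real R) = real (card F) * real (card F) * (real R * real R)"
    by simp
  also have "\<dots> \<le> real R * real R * (real R * real R)"
    using card_prime_sets_le[of R] unfolding F_def by (intro mult_right_mono mult_mono) auto
  finally have error: "(\<Sum>S\<in>F. \<Sum>T\<in>F. real R * real R) \<le> (real R) ^ 4"
    by (simp add: power4_eq_xxxx mult.assoc)
  have "{n. n < N \<and> prime n \<and> prime (n + d)} \<subseteq> {1..R} \<union> sifted"
  proof
    fix n assume n: "n \<in> {n. n < N \<and> prime n \<and> prime (n + d)}"
    show "n \<in> {1..R} \<union> sifted"
    proof (cases "n \<le> R")
      case True
      then show ?thesis using n prime_gt_0_nat[of n] by (simp add: Suc_le_eq)
    next
      case False
      have "S = {}" if S: "S \<in> F" "S \<subseteq> B n" for S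
      proof (rule ccontr)
        assume "S \<noteq> {}"
        then obtain p where p: "p \<in> S" by blast
        note S' = prime_setsD[OF S(1)[unfolded F_def]]
        have "p dvd \<Prod>S" using S'(1) p by (intro dvd_prodI)
        then have "p \<le> R" using S'(3,4) dvd_imp_le[of p "\<Prod>S"] by linarith
        moreover have "prime p" "p dvd n * (n + d)" using S(2) p by (auto simp: B_def)
        then have "p dvd n \<or> p dvd n + d" by (simp add: prime_dvd_mult_iff)
        then have "p = n \<or> p = n + d" using n \<open>prime p\<close> primes_dvd_imp_eq by blast
        ultimately show False using False by auto
      qed
      then show ?thesis using n by (simp add: sifted_def)
    qed
  qed
  then have "card {n. n < N \<and> prime n \<and> prime (n + d)} \<le> card ({1..R} \<union> sifted)"
    by (intro card_mono) (auto simp: sifted_def)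
  also have "\<dots> \<le> R + card sifted" using card_Un_le[of "{1..R}" sifted] by simp
  finally have "real (card {n. n < N \<and> prime n \<and> prime (n + d)}) \<le> real R + real (card sifted)"
    by (simp only: of_nat_add[symmetric] of_nat_le_iff)
  with sieve_bound main error show ?thesis
    unfolding F_def R_def of_nat_power by linarith
qed

text \<open>
  The sieve level is chosen so that the error \<open>R^4\<close> is at most \<open>\<surd>N\<close>, which is smaller than
  \<open>N / (ln N)^2\<close> up to a constant, while \<open>ln R\<close> keeps the order of \<open>ln N\<close>. The bound is uniform in
  \<open>d\<close>, because the errors in the sieve do not depend on \<open>d\<close>.
\<close>

theorem card_prime_pairs_le:
  assumes d: "d > 0" "even d" and N: "N \<ge> 2"
  shows "real (card {n. n < N \<and> prime n \<and> prime (n + d)})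
    \<le> 2080 * singular_factor d * (real N / (ln (real N))\<^sup>2)"
proof -
  obtain y where y: "y ^ 16 \<le> N" "N < (y + 1) ^ 16"
  proof -
    have "x \<le> x ^ 16" for x :: nat by (cases "x = 0") (auto intro: self_le_power)
    then have bound: "x ^ 16 \<le> N \<Longrightarrow> x \<le> N" for x using le_trans by blast
    \<comment> \<open>\<open>y\<close> is the integer part of the sixteenth root of \<open>N\<close>, so that \<open>R^4 = y^8 \<le> \<surd>N\<close>.\<close>
    define y where "y = (GREATEST x. x ^ 16 \<le> N)"
    have "y ^ 16 \<le> N" unfolding y_def by (rule GreatestI_nat[of _ 0 N]) (use bound in auto)
    moreover have "\<not> (y + 1) ^ 16 \<le> N"
    proof
      assume "(y + 1) ^ 16 \<le> N"
      then have "y + 1 \<le> y" unfolding y_def using bound by (intro Greatest_le_nat[of _ _ N]) auto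
      then show False by simp
    qed
    ultimately show ?thesis using that by auto
  qed
  have y1: "y \<ge> 1" using y(2) N by (cases "y = 0") auto
  define f where "f = singular_factor d"
  define H where "H = (\<Sum>W\<in>prime_sets (y\<^sup>2). \<Prod>p\<in>W. roots d p / real p)"
  define l where "l = ln (real N)"
  have f: "f \<ge> 1" unfolding f_def by (rule singular_factor_ge_1)
  have l: "l > 0" unfolding l_def using N by (intro ln_gt_zero) simp
  have "real N \<le> real ((y + 1) ^ 16)" using y(2) by (simp only: of_nat_le_iff)
  then have "real N \<le> (real y + 1) ^ 16" by (simp add: add.commute)
  then have "l \<le> ln ((real y + 1) ^ 16)" unfolding l_def using N by (intro ln_mono) auto
  also have "\<dots> = 16 * ln (real y + 1)" by (subst ln_realpow) auto
  finally have "l\<^sup>2 \<le> (16 * ln (real y + 1))\<^sup>2" using l by (intro power_mono) auto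
  also have "\<dots> = 256 * (ln (real y + 1))\<^sup>2" by (simp add: power_mult_distrib)
  finally have "l\<^sup>2 \<le> 256 * (ln (real y + 1))\<^sup>2" .
  moreover have "(ln (real y + 1))\<^sup>2 \<le> 8 * f * H"
    unfolding f_def H_def using d(1) by (rule ln_squared_le_sieve_sum)
  ultimately have lH: "l\<^sup>2 \<le> 2048 * f * H" by linarith
  have "0 < l\<^sup>2" using l by simp
  then have "0 < 2048 * f * H" using lH by (rule less_le_trans)
  then have H: "H > 0" using f by (simp add: zero_less_mult_iff)
  \<comment> \<open>The factor is \<open>8 * 16^2\<close>: the loss in the sieve sum, and \<open>ln N \<le> 16 ln (y + 1)\<close>.\<close>
  have main: "real N / H \<le> 2048 * f * (real N / l\<^sup>2)"
  proof -
    have "real N * l\<^sup>2 \<le> real N * (2048 * f * H)" using lH by (intro mult_left_mono) auto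
    then show ?thesis using H l by (simp add: field_simps)
  qed
  have l_sqrt: "l\<^sup>2 \<le> 16 * sqrt (real N)"
    unfolding l_def using N by (intro ln_squared_le_sqrt) simp
  have "real (y ^ 8) \<le> sqrt (real N)"
    using y(1) by (intro real_le_rsqrt) (simp flip: power_mult of_nat_power)
  also have "sqrt (real N) = real N / sqrt (real N)" by (simp add: real_div_sqrt)
  also have "\<dots> \<le> real N / (l\<^sup>2 / 16)"
    using l_sqrt l N by (intro divide_left_mono mult_pos_pos) auto
  finally have y8: "real (y ^ 8) \<le> 16 * (real N / l\<^sup>2)" by (simp add: mult.commute)
  have y2: "real (y ^ 2) \<le> real (y ^ 8)" unfolding of_nat_le_iff using y1 by (intro power_increasing) auto
  have "real (card {n. n < N \<and> prime n \<and> prime (n + d)}) \<le> real (y\<^sup>2) + real N / H + real ((y\<^sup>2) ^ 4)"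
    unfolding H_def using card_sifted_prime_pairs[OF d y1, of N] .
  also have "(y\<^sup>2) ^ 4 = y ^ 8" by (simp flip: power_mult)
  also have "real (y\<^sup>2) + real N / H + real (y ^ 8) \<le> 2048 * f * (real N / l\<^sup>2) + 32 * (real N / l\<^sup>2)"
    using main y8 y2 by linarith
  also have "\<dots> \<le> 2048 * f * (real N / l\<^sup>2) + 32 * f * (real N / l\<^sup>2)"
    using f by (intro add_left_mono mult_right_mono) auto
  finally show ?thesis by (simp add: f_def l_def algebra_simps)
qed

lemma card_primes_small_gap:
  assumes N: "N \<ge> 2"
  shows "real (card {q. q < N \<and> prime q \<and> (\<exists>d\<in>{1..D}. even d \<and> prime (q + d))})
    \<le> 4160 * real D * (real N / (ln (real N))\<^sup>2)"
proof -
  define E where "E = {d\<in>{1..D}. even d}"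
  define Q where "Q d = {n. n < N \<and> prime n \<and> prime (n + d)}" for d
  define z where "z = real N / (ln (real N))\<^sup>2"
  have "{q. q < N \<and> prime q \<and> (\<exists>d\<in>{1..D}. even d \<and> prime (q + d))} = (\<Union>d\<in>E. Q d)"
    by (auto simp: E_def Q_def)
  then have "real (card {q. q < N \<and> prime q \<and> (\<exists>d\<in>{1..D}. even d \<and> prime (q + d))}) \<le> (\<Sum>d\<in>E. real (card (Q d)))"
    using card_UN_le[of E Q] by (simp add: E_def flip: of_nat_sum)
  also have "\<dots> \<le> (\<Sum>d\<in>E. 2080 * singular_factor d * z)"
    unfolding Q_def z_def using N by (intro sum_mono card_prime_pairs_le) (auto simp: E_def)
  also have "\<dots> \<le> (\<Sum>d=1..D. 2080 * singular_factor d * z)"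
  proof (rule sum_mono2)
    show "0 \<le> 2080 * singular_factor d * z" for d
      using singular_factor_ge_1[of d] by (intro mult_nonneg_nonneg) (auto simp: z_def)
  qed (auto simp: E_def)
  also have "\<dots> = 2080 * z * (\<Sum>d=1..D. singular_factor d)"
    by (subst sum_distrib_left) (simp add: mult_ac)
  also have "\<dots> \<le> 2080 * z * (2 * real D)"
    by (intro mult_left_mono sum_singular_factor_le) (auto simp: z_def)
  finally show ?thesis by (simp add: z_def mult_ac)
qed

section \<open>Counting prime gaps\<close>

lemma nth_prime_add_gap: "1 \<le> n \<Longrightarrow> nth_prime n + prime_gap n = nth_prime (n + 1)"
  using nth_prime_strict_mono[of n "n + 1"] by (simp add: prime_gap_def)

lemma prime_gap_even_ge_2:
  assumes "2 \<le> n"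
  shows "even (prime_gap n)" "2 \<le> prime_gap n"
proof -
  \<comment> \<open>The gap after the prime \<open>2\<close> is the only odd one.\<close>
  have gt: "nth_prime n > 2" "nth_prime (n + 1) > 2"
    using nth_prime_strict_mono[of 1 n] nth_prime_strict_mono[of 1 "n + 1"] assms
      prime_ge_2_nat[OF prime_nth_prime[of 1]] by auto
  then have "odd (nth_prime n)" "odd (nth_prime (n + 1))"
    using prime_odd_nat prime_nth_prime by blast+
  then show e: "even (prime_gap n)"
    using nth_prime_add_gap[of n] assms by (metis even_add le_trans one_le_numeral)
  have "0 < prime_gap n"
    using nth_prime_strict_mono[of n "n + 1"] assms by (simp add: prime_gap_def)
  then show "2 \<le> prime_gap n" using e by (cases "prime_gap n = 1") auto
qed

lemma eventually_card_prime_gap_le: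
  "\<forall>\<^sub>F X :: real in at_top. \<forall>D.
     real (card {n. 2 \<le> n \<and> real n \<le> X \<and> prime_gap n \<le> D}) \<le> 20800 * real D * (X / ln X)"
  using eventually_nth_prime_less eventually_ge_at_top[of 2]
proof eventually_elim
  case (elim X)
  then obtain N :: nat where N: "X \<le> real N" "real N \<le> 5 * X * ln X"
    and less: "\<And>n. 1 \<le> n \<Longrightarrow> real n \<le> X \<Longrightarrow> nth_prime n < N" by blast
  have lnX: "0 < ln X" using elim by (intro ln_gt_zero) simp
  show ?case
  proof
    fix D
    define A where "A = {n. 2 \<le> n \<and> real n \<le> X \<and> prime_gap n \<le> D}"
    define Q where "Q = {q. q < N \<and> prime q \<and> (\<exists>d\<in>{1..D}. even d \<and> prime (q + d))}"
    have "inj_on nth_prime A"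
    proof (rule inj_onI)
      fix m n assume "m \<in> A" "n \<in> A" "nth_prime m = nth_prime n"
      then show "m = n"
        using nth_prime_strict_mono[of m n] nth_prime_strict_mono[of n m]
        by (cases m n rule: linorder_cases) (auto simp: A_def)
    qed
    moreover have "nth_prime ` A \<subseteq> Q"
    proof
      fix q assume "q \<in> nth_prime ` A"
      then obtain n where n: "n \<in> A" "q = nth_prime n" by (rule imageE)
      have "prime (q + prime_gap n)" using nth_prime_add_gap[of n] n prime_nth_prime by (auto simp: A_def)
      then show "q \<in> Q"
        using n less[of n] prime_gap_even_ge_2[of n] prime_nth_prime[of n] by (auto simp: A_def Q_def)
    qed
    moreover have "finite Q" by (simp add: Q_def)
    ultimately have "card A \<le> card Q" by (rule card_inj_on_le)
    then have "real (card A) \<le> real (card Q)" by simp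
    also have "\<dots> \<le> 4160 * real D * (real N / (ln (real N))\<^sup>2)"
      unfolding Q_def using N elim by (intro card_primes_small_gap) linarith
    also have "\<dots> \<le> 4160 * real D * (5 * X * ln X / (ln X)\<^sup>2)"
    proof (intro mult_left_mono frac_le power_mono)
      show "ln X \<le> ln (real N)" using N elim by (intro ln_mono) linarith+
    qed (use N lnX elim in auto)
    also have "\<dots> = 20800 * real D * (X / ln X)" using lnX by (simp add: power2_eq_square)
    finally show "real (card A) \<le> 20800 * real D * (X / ln X)" .
  qed
qed

section \<open>Summation over dyadic blocks\<close>

text \<open>
  Comparable quantities have comparable powers; the maximum covers both signs of the exponent.
\<close>

lemma powr_le_max_mult_powr:
  fixes a b k x :: real
  assumes "0 < a" "0 < k" "a * k \<le> x" "x \<le> b * k"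
  shows "x powr \<alpha> \<le> max (a powr \<alpha>) (b powr \<alpha>) * k powr \<alpha>"
proof -
  have x: "0 < x" using assms mult_pos_pos[of a k] by linarith
  then have "0 < b * k" using assms by linarith
  then have b: "0 < b" using assms by (simp add: zero_less_mult_iff)
  have "x powr \<alpha> \<le> max ((a * k) powr \<alpha>) ((b * k) powr \<alpha>)"
  proof (cases "\<alpha> \<ge> 0")
    case True
    then have "x powr \<alpha> \<le> (b * k) powr \<alpha>" using assms x by (intro powr_mono2) auto
    then show ?thesis by simp
  next
    case False
    then have "x powr \<alpha> \<le> (a * k) powr \<alpha>" using assms x by (intro powr_mono2') auto
    then show ?thesis by simp
  qed
  also have "\<dots> = max (a powr \<alpha>) (b powr \<alpha>) * k powr \<alpha>"
    using assms b by (simp add: powr_mult max_mult_distrib_right)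
  finally show ?thesis .
qed

text \<open>
  With \<open>u = ln d\<close> this says that \<open>(ln d) powr \<alpha> / d\<close> decreases once \<open>ln d \<ge> \<alpha>\<close>. It follows from
  \<open>\<alpha> ln (u / L) \<le> (\<alpha> / L) (u - L) \<le> u - L\<close>.
\<close>

lemma powr_over_exp_antimono:
  fixes L u \<alpha> :: real
  assumes L: "0 < L" "\<alpha> \<le> L" and u: "L \<le> u"
  shows "u powr \<alpha> / exp u \<le> L powr \<alpha> / exp L"
proof -
  have "\<alpha> * ln (u / L) \<le> u - L"
  proof (cases "\<alpha> \<ge> 0")
    case True
    have "\<alpha> * ln (u / L) \<le> \<alpha> * (u / L - 1)"
      using True L u by (intro mult_left_mono ln_le_minus_one) auto
    also have "\<dots> = (\<alpha> / L) * (u - L)" using L by (simp add: field_simps)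
    also have "\<dots> \<le> 1 * (u - L)" using L u by (intro mult_right_mono) auto
    finally show ?thesis by simp
  next
    case False
    have "0 \<le> ln (u / L)" using L u by (intro ln_ge_zero) auto
    then have "\<alpha> * ln (u / L) \<le> 0" using False by (intro mult_nonpos_nonneg) auto
    then show ?thesis using u by simp
  qed
  then have "\<alpha> * ln u - u \<le> \<alpha> * ln L - L"
    using L u by (simp add: ln_div algebra_simps)
  then have "exp (\<alpha> * ln u - u) \<le> exp (\<alpha> * ln L - L)" by simp
  then show ?thesis using L u by (simp add: powr_def exp_diff)
qed

text \<open>
  For negative exponents the sum is compared with the integral of \<open>x powr \<alpha>\<close> by the mean value
  theorem. The interval from \<open>0\<close> to \<open>1\<close>, where the derivative blows up at the left end, is treated
  separately.
\<close>

lemma sum_powr_le: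
  fixes \<alpha> :: real
  assumes "\<alpha> > -1"
  shows "(\<Sum>k=1..K. real k powr \<alpha>) \<le> max 1 (1 / (1 + \<alpha>)) * real K powr (1 + \<alpha>)"
proof (cases "\<alpha> \<ge> 0")
  case True
  have "(\<Sum>k=1..K. real k powr \<alpha>) \<le> (\<Sum>k=1..K. real K powr \<alpha>)"
    using True by (intro sum_mono powr_mono2) auto
  also have "\<dots> = 1 * real K powr (1 + \<alpha>)" by (cases "K = 0") (auto simp: powr_add)
  also have "\<dots> \<le> max 1 (1 / (1 + \<alpha>)) * real K powr (1 + \<alpha>)" by (intro mult_right_mono) auto
  finally show ?thesis .
next
  case False
  define s where "s = 1 + \<alpha>"
  have s: "0 < s" "s < 1" using False assms by (auto simp: s_def)
  have step: "s * real (Suc k) powr \<alpha> \<le> real (Suc k) powr s - real k powr s" for k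
  proof (cases "k = 0")
    case True
    then show ?thesis using s by simp
  next
    case k: False
    have "\<exists>z. real k < z \<and> z < real (Suc k) \<and>
        real (Suc k) powr s - real k powr s = (real (Suc k) - real k) * (s * z powr (s - 1))"
      using k by (intro MVT2) (auto intro!: derivative_eq_intros has_real_derivative_powr)
    then obtain z where z: "real k < z" "z < real (Suc k)"
      "real (Suc k) powr s - real k powr s = s * z powr \<alpha>"
      by (auto simp: s_def)
    have "real (Suc k) powr \<alpha> \<le> z powr \<alpha>" using False z k by (intro powr_mono2') auto
    then show ?thesis using z s by (simp add: mult_left_mono)
  qed
  have "s * (\<Sum>k=1..K. real k powr \<alpha>) \<le> real K powr s"
  proof (induction K)
    case (Suc K)
    then show ?case using step[of K] by (simp add: distrib_left)
  qed simp
  then have "(\<Sum>k=1..K. real k powr \<alpha>) \<le> 1 / s * real K powr s"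
    using s by (simp add: field_simps)
  also have "\<dots> \<le> max 1 (1 / s) * real K powr s" by (intro mult_right_mono) auto
  finally show ?thesis by (simp add: s_def)
qed

lemma sum_inverse_le_ln:
  assumes "K \<ge> 1"
  shows "(\<Sum>k=1..K. 1 / real k) \<le> 1 + ln (real K)"
  using assms
proof (induction K rule: dec_induct)
  case (step K)
  have "ln (real K / real (Suc K)) \<le> real K / real (Suc K) - 1"
    using step by (intro ln_le_minus_one) auto
  then have "1 / real (Suc K) \<le> ln (real (Suc K)) - ln (real K)"
    using step by (simp add: ln_div field_simps)
  then show ?case using step by simp
qed simp

text \<open>
  The factor by which the bound exceeds \<open>X / ln X\<close>, as a function of \<open>L = ln (ln X)\<close>. It is of the
  order of the integral of \<open>x powr \<alpha>\<close> from \<open>1\<close> to \<open>L\<close>.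
\<close>

definition growth :: "real \<Rightarrow> real \<Rightarrow> real" where
  "growth \<alpha> L = (if \<alpha> > -1 then L powr (1 + \<alpha>) / (1 + \<alpha>) else ln L)"

text \<open>
  The upper limit \<open>2 L\<close> bounds the number of dyadic blocks below \<open>ln X = exp L\<close>, which is at most
  \<open>L / ln 2\<close>.
\<close>

lemma eventually_sum_powr_le_growth:
  assumes "\<alpha> \<ge> -1"
  shows "\<exists>A>0. \<forall>\<^sub>F L in at_top. (\<Sum>k=1..nat \<lfloor>2 * L\<rfloor>. real k powr \<alpha>) \<le> A * growth \<alpha> L"
proof (cases "\<alpha> > -1")
  case True
  define A where "A = max 1 (1 / (1 + \<alpha>)) * 2 powr (1 + \<alpha>) * (1 + \<alpha>)"
  have "A > 0" using True by (simp add: A_def less_max_iff_disj)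
  moreover have "\<forall>\<^sub>F L in at_top. (\<Sum>k=1..nat \<lfloor>2 * L\<rfloor>. real k powr \<alpha>) \<le> A * growth \<alpha> L"
    using eventually_ge_at_top[of 1]
  proof eventually_elim
    case (elim L)
    have "(\<Sum>k=1..nat \<lfloor>2 * L\<rfloor>. real k powr \<alpha>)
        \<le> max 1 (1 / (1 + \<alpha>)) * real (nat \<lfloor>2 * L\<rfloor>) powr (1 + \<alpha>)"
      using True by (rule sum_powr_le)
    also have "\<dots> \<le> max 1 (1 / (1 + \<alpha>)) * (2 * L) powr (1 + \<alpha>)"
      using True elim by (intro mult_left_mono powr_mono2) auto
    also have "\<dots> = A * growth \<alpha> L"
      using True elim by (simp add: A_def growth_def powr_mult)
    finally show ?case .
  qed
  ultimately show ?thesis by blast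
next
  case False
  then have \<alpha>: "\<alpha> = -1" using assms by simp
  have "\<forall>\<^sub>F L :: real in at_top. 1 + ln (2 * L) \<le> 2 * ln L" by real_asymp
  then have "\<forall>\<^sub>F L in at_top. (\<Sum>k=1..nat \<lfloor>2 * L\<rfloor>. real k powr \<alpha>) \<le> 2 * growth \<alpha> L"
    using eventually_ge_at_top[of 1]
  proof eventually_elim
    case (elim L)
    have K: "nat \<lfloor>2 * L\<rfloor> \<ge> 1" "real (nat \<lfloor>2 * L\<rfloor>) \<le> 2 * L" using elim by linarith+
    have "(\<Sum>k=1..nat \<lfloor>2 * L\<rfloor>. real k powr \<alpha>) = (\<Sum>k=1..nat \<lfloor>2 * L\<rfloor>. 1 / real k)"
      unfolding \<alpha> by (intro sum.cong refl) (simp add: powr_minus inverse_eq_divide)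
    also have "\<dots> \<le> 1 + ln (real (nat \<lfloor>2 * L\<rfloor>))" using K(1) by (rule sum_inverse_le_ln)
    also have "\<dots> \<le> 1 + ln (2 * L)" using K by (intro add_left_mono ln_mono) auto
    also have "\<dots> \<le> 2 * growth \<alpha> L" using elim by (simp add: growth_def \<alpha>)
    finally show ?case .
  qed
  then show ?thesis by (intro exI[of _ 2]) simp
qed

lemma eventually_powr_le_growth:
  assumes "\<alpha> \<ge> -1"
  shows "\<forall>\<^sub>F L in at_top. L powr \<alpha> \<le> (2 + \<alpha>) * growth \<alpha> L"
proof (cases "\<alpha> > -1")
  case True
  show ?thesis using eventually_ge_at_top[of 1]
  proof eventually_elim
    case (elim L)
    have "L powr \<alpha> \<le> 1 * L powr (1 + \<alpha>)" using elim by (simp add: powr_mono)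
    also have "\<dots> \<le> ((2 + \<alpha>) / (1 + \<alpha>)) * L powr (1 + \<alpha>)"
      using True by (intro mult_right_mono) auto
    finally show ?case using True by (simp add: growth_def)
  qed
next
  case False
  then have \<alpha>: "\<alpha> = -1" using assms by simp
  have "\<forall>\<^sub>F L :: real in at_top. 1 / L \<le> ln L" by real_asymp
  then show ?thesis using eventually_gt_at_top[of 0]
    by eventually_elim (simp add: \<alpha> growth_def powr_minus inverse_eq_divide)
qed

theorem theorem1p3:
  fixes \<alpha> :: real
  assumes "\<alpha> \<ge> -1"
  shows "\<exists>C>0. \<forall>\<^sub>F X :: real in at_top.
    \<bar>\<Sum>n | 2 \<le> n \<and> real n \<le> X. ln (real (prime_gap n)) powr \<alpha> / real (prime_gap n)\<bar>
      \<le> C * (if \<alpha> > -1 then X / ln X * (ln (ln X) powr (1 + \<alpha>) / (1 + \<alpha>))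
             else X * ln (ln (ln X)) / ln X)"
proof -
  define c where "c = max (ln 2 powr \<alpha>) ((2 * ln 2) powr \<alpha>)"
  define t where "t n = ln (real (prime_gap n)) powr \<alpha> / real (prime_gap n)" for n
  have c: "c > 0" by (simp add: c_def less_max_iff_disj)
  obtain A where A: "A > 0"
    and sum_A: "\<forall>\<^sub>F L in at_top. (\<Sum>k=1..nat \<lfloor>2 * L\<rfloor>. real k powr \<alpha>) \<le> A * growth \<alpha> L"
    using eventually_sum_powr_le_growth[OF assms] by blast
  \<comment> \<open>Small gaps give the first summand, where \<open>41600 = 2 * 20800\<close> comes from \<open>2^(k+1) / 2^k\<close>, and large gaps the second.\<close>
  define C where "C = 41600 * c * A + (2 + \<alpha>)"
  have "C > 0" using A c assms by (simp add: C_def add_pos_pos)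
  have lnln: "filterlim (\<lambda>X :: real. ln (ln X)) at_top at_top" by real_asymp
  have "\<forall>\<^sub>F X in at_top. \<bar>\<Sum>n | 2 \<le> n \<and> real n \<le> X. t n\<bar> \<le> C * (X / ln X * growth \<alpha> (ln (ln X)))"
    using eventually_card_prime_gap_le eventually_compose_filterlim[OF sum_A lnln]
      eventually_compose_filterlim[OF eventually_powr_le_growth[OF assms] lnln]
      eventually_compose_filterlim[OF eventually_ge_at_top[of "max 1 \<alpha>"] lnln]
      eventually_ge_at_top[of 3]
  proof eventually_elim
    case (elim X)
    note count = elim(1)[rule_format]
    define L where "L = ln (ln X)"
    define K where "K = nat \<lfloor>2 * L\<rfloor>"
    define Z where "Z = X / ln X"
    define I where "I = {n. 2 \<le> n \<and> real n \<le> X}"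
    define S where "S = {n\<in>I. real (prime_gap n) \<le> ln X}"
    \<comment> \<open>\<open>\<kappa> n\<close> is the dyadic block of the gap.\<close>
    define \<kappa> where "\<kappa> n = nat \<lfloor>log 2 (real (prime_gap n))\<rfloor>" for n
    have L: "L \<ge> 1" "L \<ge> \<alpha>" using elim(4) by (auto simp: L_def)
    have lnX: "ln X > 0" using elim(5) by (intro ln_gt_zero) simp
    have expL: "exp L = ln X" unfolding L_def using lnX by simp
    have Z: "Z > 0" using lnX elim(5) by (simp add: Z_def)
    have I_sub: "I \<subseteq> {1..nat \<lfloor>X\<rfloor>}" by (auto simp: I_def le_nat_floor)
    have finI: "finite I" using I_sub finite_subset by blast
    have finS: "finite S" using finI by (simp add: S_def)
    have gap: "2 \<le> prime_gap n" if "n \<in> I" for n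
      using that prime_gap_even_ge_2(2) by (simp add: I_def)
    have t_nonneg: "0 \<le> t n" for n by (simp add: t_def)

    have \<kappa>: "\<kappa> n \<in> {1..K}" "2 ^ \<kappa> n \<le> prime_gap n" "prime_gap n < 2 ^ (\<kappa> n + 1)"
      if n: "n \<in> S" for n
    proof -
      define g where "g = real (prime_gap n)"
      have g: "2 \<le> g" "g \<le> ln X" using n gap[of n] by (auto simp: S_def g_def)
      have log1: "1 \<le> log 2 g" using g by (simp add: le_log_iff)
      have \<kappa>_le: "real (\<kappa> n) \<le> log 2 g" and \<kappa>_gt: "log 2 g < real (\<kappa> n) + 1" and \<kappa>1: "1 \<le> \<kappa> n"
        unfolding \<kappa>_def g_def[symmetric] using log1 by linarith+
      have "2 powr real (\<kappa> n) \<le> g" using \<kappa>_le g by (simp add: le_log_iff)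
      then have "real (2 ^ \<kappa> n) \<le> real (prime_gap n)" by (simp add: powr_realpow g_def)
      then show "2 ^ \<kappa> n \<le> prime_gap n" by (simp only: of_nat_le_iff)
      have "g < 2 powr (real (\<kappa> n + 1))" using \<kappa>_gt g by (simp add: log_less_iff add.commute)
      then have "real (prime_gap n) < real (2 ^ (\<kappa> n + 1))" by (simp only: powr_realpow g_def) simp
      then show "prime_gap n < 2 ^ (\<kappa> n + 1)" by (simp only: of_nat_less_iff)
      have "ln g \<le> L" unfolding L_def using g by (intro ln_mono) linarith+
      have "real (\<kappa> n) \<le> ln g / ln 2" using \<kappa>_le by (simp add: log_def)
      also have "\<dots> \<le> L / (1 / 2)"
        using \<open>ln g \<le> L\<close> L ln2_ge_two_thirds by (intro frac_le) auto
      finally have "\<kappa> n \<le> K" unfolding K_def by (intro le_nat_floor) simp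
      then show "\<kappa> n \<in> {1..K}" using \<kappa>1 by simp
    qed

    have block: "(\<Sum>n | n \<in> S \<and> \<kappa> n = k. t n) \<le> 41600 * c * Z * real k powr \<alpha>"
      if k: "k \<in> {1..K}" for k
    proof -
      have "t n \<le> c * real k powr \<alpha> / 2 ^ k" if n: "n \<in> {n. n \<in> S \<and> \<kappa> n = k}" for n
      proof -
        define g where "g = real (prime_gap n)"
        have "2 ^ k \<le> prime_gap n" "prime_gap n \<le> 2 ^ (k + 1)" using \<kappa>[of n] n by auto
        then have "real (2 ^ k) \<le> g" "g \<le> real (2 ^ (k + 1))"
          unfolding g_def of_nat_le_iff by auto
        then have g: "2 ^ k \<le> g" "g \<le> 2 ^ (k + 1)" by simp_all
        have g0: "0 < g" using g(1) less_le_trans[of 0 "2 ^ k" g] by simp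
        have "ln (2 ^ k) \<le> ln g" "ln g \<le> ln (2 ^ (k + 1))" using g g0 by (auto intro: ln_mono)
        then have lng: "real k * ln 2 \<le> ln g" "ln g \<le> real (k + 1) * ln 2"
          by (simp_all only: ln_realpow zero_less_numeral)
        have "real (k + 1) * ln 2 \<le> (2 * real k) * ln 2" using k by (intro mult_right_mono) auto
        also have "\<dots> = (2 * ln 2) * real k" by simp
        finally have "ln g \<le> (2 * ln 2) * real k" using lng by linarith
        then have "ln g powr \<alpha> \<le> c * real k powr \<alpha>"
          unfolding c_def using lng k by (intro powr_le_max_mult_powr) (auto simp: mult_ac)
        then show ?thesis unfolding t_def g_def[symmetric]
          using g g0 c by (intro frac_le) auto
      qed
      then have "(\<Sum>n | n \<in> S \<and> \<kappa> n = k. t n)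
          \<le> real (card {n. n \<in> S \<and> \<kappa> n = k}) * (c * real k powr \<alpha> / 2 ^ k)"
        by (rule sum_bounded_above)
      also have "\<dots> \<le> 20800 * real (2 ^ (k + 1)) * Z * (c * real k powr \<alpha> / 2 ^ k)"
      proof (rule mult_right_mono)
        have "{n. n \<in> S \<and> \<kappa> n = k} \<subseteq> {n. 2 \<le> n \<and> real n \<le> X \<and> prime_gap n \<le> 2 ^ (k + 1)}"
          using \<kappa>(3) by (fastforce simp: S_def I_def)
        moreover have "finite {n. 2 \<le> n \<and> real n \<le> X \<and> prime_gap n \<le> 2 ^ (k + 1)}"
          by (rule finite_subset[OF _ finI]) (auto simp: I_def)
        ultimately have "real (card {n. n \<in> S \<and> \<kappa> n = k})
            \<le> real (card {n. 2 \<le> n \<and> real n \<le> X \<and> prime_gap n \<le> 2 ^ (k + 1)})"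
          by (simp add: card_mono)
        also have "\<dots> \<le> 20800 * real (2 ^ (k + 1)) * Z" unfolding Z_def by (rule count)
        finally show "real (card {n. n \<in> S \<and> \<kappa> n = k}) \<le> 20800 * real (2 ^ (k + 1)) * Z" .
      qed (use c in simp)
      also have "\<dots> = 41600 * c * Z * real k powr \<alpha>" by simp
      finally show ?thesis .
    qed

    have "(\<Sum>n\<in>S. t n) = (\<Sum>k=1..K. \<Sum>n | n \<in> S \<and> \<kappa> n = k. t n)"
      using \<kappa>(1) by (intro sum.group[symmetric] finS) auto
    also have "\<dots> \<le> (\<Sum>k=1..K. 41600 * c * Z * real k powr \<alpha>)" by (intro sum_mono block)
    also have "\<dots> = 41600 * c * Z * (\<Sum>k=1..K. real k powr \<alpha>)" by (simp add: sum_distrib_left)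
    also have "\<dots> \<le> 41600 * c * Z * (A * growth \<alpha> L)"
      using elim(2) c Z unfolding K_def L_def by (intro mult_left_mono) auto
    finally have small: "(\<Sum>n\<in>S. t n) \<le> 41600 * c * Z * (A * growth \<alpha> L)" .

    \<comment> \<open>Gaps above \<open>ln X\<close> are so large that the trivial count suffices.\<close>
    have "t n \<le> L powr \<alpha> / ln X" if n: "n \<in> I - S" for n
    proof -
      define g where "g = real (prime_gap n)"
      have g: "ln X < g" using n by (auto simp: S_def g_def)
      then have "ln (ln X) \<le> ln g" using lnX by (intro ln_mono) auto
      then have "ln g powr \<alpha> / exp (ln g) \<le> L powr \<alpha> / exp L"
        using L by (intro powr_over_exp_antimono) (auto simp: L_def)
      then show ?thesis using g lnX by (simp add: t_def g_def[symmetric] expL)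
    qed
    then have "(\<Sum>n\<in>I - S. t n) \<le> real (card (I - S)) * (L powr \<alpha> / ln X)"
      by (rule sum_bounded_above)
    also have "\<dots> \<le> X * (L powr \<alpha> / ln X)"
    proof (rule mult_right_mono)
      have "card (I - S) \<le> card {1..nat \<lfloor>X\<rfloor>}" using I_sub by (intro card_mono) auto
      then show "real (card (I - S)) \<le> X" using elim(5) by simp linarith
    qed (use lnX in simp)
    also have "\<dots> = Z * L powr \<alpha>" by (simp add: Z_def)
    also have "\<dots> \<le> Z * ((2 + \<alpha>) * growth \<alpha> L)"
      using elim(3) Z unfolding L_def by (intro mult_left_mono) auto
    finally have large: "(\<Sum>n\<in>I - S. t n) \<le> Z * ((2 + \<alpha>) * growth \<alpha> L)" .

    have "(\<Sum>n\<in>I. t n) = (\<Sum>n\<in>I - S. t n) + (\<Sum>n\<in>S. t n)"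
      by (rule sum.subset_diff[OF _ finI]) (auto simp: S_def)
    also have "\<dots> \<le> C * (Z * growth \<alpha> L)"
      using small large by (simp add: C_def algebra_simps)
    finally show ?case
      using t_nonneg by (simp add: I_def Z_def L_def sum_nonneg)
  qed
  then have "\<exists>C>0. \<forall>\<^sub>F X in at_top.
      \<bar>\<Sum>n | 2 \<le> n \<and> real n \<le> X. t n\<bar> \<le> C * (X / ln X * growth \<alpha> (ln (ln X)))"
    using \<open>C > 0\<close> by (intro exI[of _ C] conjI)
  moreover have "X / ln X * growth \<alpha> (ln (ln X)) = (if \<alpha> > -1
      then X / ln X * (ln (ln X) powr (1 + \<alpha>) / (1 + \<alpha>)) else X * ln (ln (ln X)) / ln X)" for X
    by (simp add: growth_def)
  ultimately show ?thesis unfolding t_def by (simp only:)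
qed

end
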